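(* If $X$ is a path connected, locally path connected separable metric space then $\pi_1(X)$ is not a free product of uncountably many nontrivial groups. More generally, if $\kappa$ is an infinite cardinal and $X$ is a path connected, locally path connected $\kappa$-Lindel\"of metric space then $\pi_1(X)$ is not a free product of more than $\kappa$ many nontrivial groups.
   Context: A space is $\kappa$-Lindel\"of if every open cover of it contains a subcover of cardinality at most $\kappa$. *)

theory Defs
  imports "HOL-Analysis.Analysis" "HOL-Algebra.Group"
begin

unbundle cardinal_syntax

definition kappa_Lindelof_space :: "'k rel \<Rightarrow> 'a topology \<Rightarrow> bool" where
  "kappa_Lindelof_space \<kappa> X \<longleftrightarrow>
     (\<forall>\<U>. (\<forall>U \<in> \<U>. openin X U) \<and> \<Union>\<U> = topspace X
        \<longrightarrow> (\<exists>\<V>. |\<V>| \<le>o \<kappa> \<and> \<V> \<subseteq> \<U> \<and> \<Union>\<V> = topspace X))"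


subsection \<open>The fundamental group\<close>

definition loops_at :: "'a::topological_space set \<Rightarrow> 'a \<Rightarrow> (real \<Rightarrow> 'a) set" where
  "loops_at X x = {p. path p \<and> path_image p \<subseteq> X \<and> pathstart p = x \<and> pathfinish p = x}"

text \<open>Paths are functions on all of \<open>real\<close>, of which only the restriction to \<open>{0..1}\<close> matters;
  \<^const>\<open>homotopic_paths\<close> identifies functions that agree there.\<close>

definition loop_homotopy :: "'a::topological_space set \<Rightarrow> 'a \<Rightarrow> (real \<Rightarrow> 'a) rel" where
  "loop_homotopy X x = {(p, q). p \<in> loops_at X x \<and> q \<in> loops_at X x \<and> homotopic_paths X p q}"

definition fundamental_group :: "'a::topological_space set \<Rightarrow> 'a \<Rightarrow> (real \<Rightarrow> 'a) set monoid" where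
  "fundamental_group X x =
     \<lparr>carrier = loops_at X x // loop_homotopy X x,
      monoid.mult = (\<lambda>A B. \<Union>p\<in>A. \<Union>q\<in>B. loop_homotopy X x `` {p +++ q}),
      one = loop_homotopy X x `` {\<lambda>_. x}\<rparr>"


subsection \<open>Free products of groups\<close>

text \<open>Elements of the free product are reduced words: lists of letters \<open>(i, g)\<close> with
  \<open>g\<close> a nonidentity element of \<open>G i\<close>, in which neighbouring letters come from different factors.
  The product of two words is the reduced form of their concatenation.\<close>

definition reduced_words :: "'i set \<Rightarrow> ('i \<Rightarrow> ('g, 'm) monoid_scheme) \<Rightarrow> ('i \<times> 'g) list set" where
  "reduced_words I G =
     {w. set w \<subseteq> (SIGMA i:I. carrier (G i) - {\<one>\<^bsub>G i\<^esub>}) \<and> distinct_adj (map fst w)}"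

fun letter_mult ::
  "('i \<Rightarrow> ('g, 'm) monoid_scheme) \<Rightarrow> 'i \<times> 'g \<Rightarrow> ('i \<times> 'g) list \<Rightarrow> ('i \<times> 'g) list" where
  "letter_mult G (i, g) [] = (if g = \<one>\<^bsub>G i\<^esub> then [] else [(i, g)])"
| "letter_mult G (i, g) ((j, h) # w) =
     (if g = \<one>\<^bsub>G i\<^esub> then (j, h) # w
      else if i \<noteq> j then (i, g) # (j, h) # w
      else if g \<otimes>\<^bsub>G i\<^esub> h = \<one>\<^bsub>G i\<^esub> then w
      else (i, g \<otimes>\<^bsub>G i\<^esub> h) # w)"

definition free_product :: "'i set \<Rightarrow> ('i \<Rightarrow> ('g, 'm) monoid_scheme) \<Rightarrow> ('i \<times> 'g) list monoid" where
  "free_product I G =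
     \<lparr>carrier = reduced_words I G, monoid.mult = foldr (letter_mult G), one = []\<rparr>"

end

theory Submission
  imports Defs "HOL-Library.Countable_Set_Type"
begin

text \<open>
  Call a set of indices small if it has at most \<open>\<kappa>\<close> elements, and for a set \<open>J\<close> of indices let
  \<open>r\<^sub>J\<close> be the endomorphism of the free product that kills the factors in \<open>J\<close>.

  The heart of the proof is that every point \<open>x\<close> has a ball whose loops at \<open>x\<close> are all killed by
  \<open>r\<^sub>J\<close> for some small \<open>J\<close>. Otherwise a \<open>\<Delta>\<close>-system argument yields one small \<open>J\<close> and
  loops \<open>c\<^sub>n\<close>, \<open>d\<^sub>n\<close> within \<open>1/n\<close> of \<open>x\<close> whose images under \<open>r\<^sub>J\<close> are nontrivial words with no
  factor in common. Since these loops shrink, there are loops \<open>w\<^sub>n\<close> with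
  \<open>w\<^sub>n = w c\<^sub>n w\<inverse> d\<^sub>n w\<close> for \<open>w = w\<^bsub>n+1\<^esub>\<close>. For words \<open>c\<close>, \<open>d\<close> without common factor,
  \<open>x c x\<inverse> d x\<close> is always longer than \<open>x\<close>, so the image of \<open>w\<^sub>0\<close> would have length at least
  \<open>n\<close> for every \<open>n\<close>.

  By the Lindelof property and local path connectedness there is then a cover by at most
  \<open>\<kappa>\<close> path connected open sets and one small \<open>J\<close> such that \<open>r\<^sub>J\<close> kills all loops in the
  union of any two intersecting members. The image of the fundamental group under \<open>r\<^sub>J\<close> is then
  generated by one element for each pair of members, so it only involves a small set of factors;
  as it contains all factors outside \<open>J\<close>, there are at most \<open>\<kappa>\<close> factors.
\<close>

subsection \<open>Reduced words\<close>

locale group_family =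
  fixes I :: "'i set" and G :: "'i \<Rightarrow> ('g, 'm) monoid_scheme"
  assumes grp: "\<And>i. i \<in> I \<Longrightarrow> group (G i)"
begin

abbreviation "letters \<equiv> SIGMA i:I. carrier (G i)"
abbreviation "words \<equiv> reduced_words I G"
abbreviation "lm \<equiv> letter_mult G"

definition word_inv :: "('i \<times> 'g) list \<Rightarrow> ('i \<times> 'g) list" where
  "word_inv w = rev (map (\<lambda>(i, g). (i, inv\<^bsub>G i\<^esub> g)) w)"

definition support :: "('i \<times> 'g) list \<Rightarrow> 'i set" where
  "support w = fst ` set w"

lemma finite_support [simp]: "finite (support w)"
  by (simp add: support_def)

lemma words_Nil [simp]: "[] \<in> words"
  by (simp add: reduced_words_def)

lemma words_Cons:
  "(i, g) # w \<in> words \<longleftrightarrow>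
    i \<in> I \<and> g \<in> carrier (G i) \<and> g \<noteq> \<one>\<^bsub>G i\<^esub> \<and> w \<in> words \<and> (w = [] \<or> fst (hd w) \<noteq> i)"
  by (cases w) (auto simp: reduced_words_def)

lemma words_append:
  "u @ w \<in> words \<longleftrightarrow>
    u \<in> words \<and> w \<in> words \<and> (u = [] \<or> w = [] \<or> fst (last u) \<noteq> fst (hd w))"
  by (auto simp: reduced_words_def distinct_adj_append_iff last_map hd_map)

lemma letters_if_words: "w \<in> words \<Longrightarrow> set w \<subseteq> letters"
  by (auto simp: reduced_words_def)

lemma lm_one [simp]: "lm (i, \<one>\<^bsub>G i\<^esub>) w = w"
  by (cases "(G, (i, \<one>\<^bsub>G i\<^esub>), w)" rule: letter_mult.cases) auto

section \<open>Letters acting on reduced words, and the group structure\<close>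

lemma lm_closed:
  assumes "l \<in> letters" "w \<in> words" shows "lm l w \<in> words"
proof -
  obtain i g where l: "l = (i, g)" and i: "i \<in> I" "g \<in> carrier (G i)" using assms by auto
  interpret group "G i" using grp i by auto
  show ?thesis
  proof (cases w)
    case Nil then show ?thesis using l i by (auto simp: words_Cons)
  next
    case (Cons b v)
    obtain j h where b: "b = (j, h)" by force
    have "g \<otimes>\<^bsub>G i\<^esub> h \<in> carrier (G i)" if "i = j"
      using that assms Cons b i m_closed[of g h] by (auto simp: words_Cons)
    then show ?thesis using assms Cons l i b by (auto simp: words_Cons)
  qed
qed

text \<open>Each factor acts on the reduced words. If \<open>w\<close> begins with a letter of
  factor \<open>i\<close>, stripping it reduces the claim to associativity in \<open>G i\<close>;
  otherwise a nonidentity letter is simply prefixed. As in van der Waerden's construction,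
  associativity of the free product rests on this.\<close>

lemma lm_mult:
  assumes "i \<in> I" "g \<in> carrier (G i)" "h \<in> carrier (G i)" "w \<in> words"
  shows "lm (i, g \<otimes>\<^bsub>G i\<^esub> h) w = lm (i, g) (lm (i, h) w)"
proof -
  interpret group "G i" using grp assms by auto
  show ?thesis
  proof (cases "h = \<one>\<^bsub>G i\<^esub>")
    case True
    then show ?thesis using assms by simp
  next
    case h: False
    consider "w = [] \<or> fst (hd w) \<noteq> i" | k v where "w = (i, k) # v"
      by (cases w) (auto, metis prod.collapse)
    then show ?thesis
    proof cases
      case 1
      then have "lm (i, f) w = (if f = \<one>\<^bsub>G i\<^esub> then w else (i, f) # w)" for f
        by (cases w) auto
      then show ?thesis using assms h by (auto)
    next
      case (2 k v)
      have k: "k \<in> carrier (G i)" "k \<noteq> \<one>\<^bsub>G i\<^esub>" and v: "v = [] \<or> fst (hd v) \<noteq> i"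
        using assms 2 by (auto simp: words_Cons)
      have v': "lm (i, f) v = (if f = \<one>\<^bsub>G i\<^esub> then v else (i, f) # v)" for f
        using v by (cases v) auto
      have w: "lm (i, f) w = lm (i, f \<otimes>\<^bsub>G i\<^esub> k) v" if "f \<in> carrier (G i)" for f
        using that 2 k v' by (auto)
      have "lm (i, g) (lm (i, h) w) = lm (i, g \<otimes>\<^bsub>G i\<^esub> (h \<otimes>\<^bsub>G i\<^esub> k)) v"
        using assms k w by (auto simp: v')
      then show ?thesis using assms k w by (simp add: m_assoc)
    qed
  qed
qed

lemma foldr_closed: "set u \<subseteq> letters \<Longrightarrow> w \<in> words \<Longrightarrow> foldr lm u w \<in> words"
  by (induction u) (auto intro: lm_closed)

text \<open>The one-letter case of associativity. Something happens only when \<open>l\<close>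
  merges with the first letter of \<open>v\<close>, and then \<open>lm_mult\<close> splits the
  merged letter again.\<close>

lemma foldr_lm:
  assumes "l \<in> letters" "v \<in> words" "w \<in> words"
  shows "foldr lm (lm l v) w = lm l (foldr lm v w)"
proof -
  obtain i g where l: "l = (i, g)" and i: "i \<in> I" "g \<in> carrier (G i)" using assms by auto
  interpret group "G i" using grp i by auto
  show ?thesis
  proof (cases v)
    case Nil then show ?thesis using l by auto
  next
    case (Cons b t)
    obtain j h where b: "b = (j, h)" by force
    have t: "foldr lm t w \<in> words"
      using assms Cons b by (intro foldr_closed letters_if_words) (auto simp: words_Cons)
    show ?thesis
    proof (cases "g = \<one>\<^bsub>G i\<^esub> \<or> i \<noteq> j")
      case True then show ?thesis using Cons b l by auto
    next
      case False
      have "lm (i, g \<otimes>\<^bsub>G i\<^esub> h) (foldr lm t w) = lm (i, g) (lm (i, h) (foldr lm t w))"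
        using False t assms Cons b i by (intro lm_mult) (auto simp: words_Cons)
      then show ?thesis using False Cons b l by (auto simp: lm_one[of i])
    qed
  qed
qed

lemma foldr_assoc:
  assumes "set u \<subseteq> letters" "v \<in> words" "w \<in> words"
  shows "foldr lm (foldr lm u v) w = foldr lm u (foldr lm v w)"
  using assms by (induction u) (auto simp: foldr_lm foldr_closed)

lemma foldr_append_reduced:
  assumes "u @ w \<in> words" shows "foldr lm u w = u @ w"
  using assms
proof (induction u)
  case (Cons a u)
  obtain i g where a: "a = (i, g)" by force
  have "foldr lm u w = u @ w" and r: "(i, g) # (u @ w) \<in> words"
    using Cons a by (auto simp: words_Cons)
  then show ?case using a by (cases "u @ w") (auto simp: words_Cons)
qed simp

lemma word_inv_Cons: "word_inv ((i, g) # w) = word_inv w @ [(i, inv\<^bsub>G i\<^esub> g)]"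
  by (simp add: word_inv_def)

lemma support_word_inv [simp]: "support (word_inv w) = support w"
  by (force simp: support_def word_inv_def)

lemma word_inv_closed: "w \<in> words \<Longrightarrow> word_inv w \<in> words"
proof (induction w)
  case (Cons a w)
  obtain i g where a: "a = (i, g)" by force
  interpret group "G i" using grp Cons a by (auto simp: words_Cons)
  have "word_inv w \<noteq> [] \<Longrightarrow> fst (last (word_inv w)) = fst (hd w)"
    by (cases w) (auto simp: word_inv_def case_prod_unfold)
  then show ?case
    using Cons a by (cases "w = []") (auto simp: word_inv_Cons words_append words_Cons word_inv_def)
qed (simp add: word_inv_def)

lemma word_inv_left: "w \<in> words \<Longrightarrow> foldr lm (word_inv w) w = []"
proof (induction w)
  case (Cons a w)
  obtain i g where a: "a = (i, g)" by force
  interpret group "G i" using grp Cons a by (auto simp: words_Cons)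
  have "lm (i, inv\<^bsub>G i\<^esub> g) ((i, g) # w) = w"
    using Cons.prems a by (auto simp: words_Cons)
  then show ?case using Cons a by (simp add: word_inv_Cons words_Cons)
qed (simp add: word_inv_def)

sublocale F: group "free_product I G"
  rewrites "carrier (free_product I G) = words"
    and "monoid.mult (free_product I G) = foldr lm"
    and "one (free_product I G) = []"
proof -
  show "group (free_product I G)"
  proof (rule groupI)
    fix u assume "u \<in> carrier (free_product I G)"
    then show "\<exists>v\<in>carrier (free_product I G).
        v \<otimes>\<^bsub>free_product I G\<^esub> u = \<one>\<^bsub>free_product I G\<^esub>"
      using word_inv_left word_inv_closed by (auto simp: free_product_def)
  qed (auto simp: free_product_def foldr_closed letters_if_words foldr_assoc)
qed (auto simp: free_product_def)

lemma free_product_sel [simp]: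
  "carrier (free_product I G) = words" "monoid.mult (free_product I G) = foldr lm"
  "one (free_product I G) = []"
  by (simp_all add: free_product_def)

lemma F_inv: "w \<in> words \<Longrightarrow> inv\<^bsub>free_product I G\<^esub> w = word_inv w"
  using F.inv_equality word_inv_left word_inv_closed by blast

section \<open>Supports of products and the endomorphisms that kill factors\<close>

lemma support_lm: "support (lm l w) \<subseteq> insert (fst l) (support w)"
  by (cases "(G, l, w)" rule: letter_mult.cases) (auto simp: support_def)

lemma support_mult: "support (foldr lm u w) \<subseteq> support u \<union> support w"
proof (induction u)
  case (Cons a u)
  have "support (foldr lm (a # u) w) \<subseteq> insert (fst a) (support (foldr lm u w))"
    using support_lm[of a "foldr lm u w"] by simp
  also have "\<dots> \<subseteq> insert (fst a) (support u \<union> support w)" using Cons by blast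
  finally show ?case by (simp add: support_def)
qed simp

text \<open>Deleting letters can make letters of one factor adjacent, so the remaining ones are
  multiplied up again, starting from the empty word.\<close>

definition kill :: "'i set \<Rightarrow> ('i \<times> 'g) list \<Rightarrow> ('i \<times> 'g) list" where
  "kill J w = foldr lm (filter (\<lambda>l. fst l \<notin> J) w) []"

lemma kill_Nil [simp]: "kill J [] = []"
  by (simp add: kill_def)

lemma kill_Cons: "kill J (l # w) = (if fst l \<in> J then kill J w else lm l (kill J w))"
  by (simp add: kill_def)

lemma kill_closed: "set w \<subseteq> letters \<Longrightarrow> kill J w \<in> words"
  unfolding kill_def by (intro foldr_closed) auto

lemma support_kill: "support (kill J w) \<subseteq> support w - J"
  using support_mult[of "filter (\<lambda>l. fst l \<notin> J) w" "[]"] by (auto simp: kill_def support_def)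

text \<open>The letter step towards \<open>kill_mult\<close>. In the delicate case two letters
  merge; they belong to the same factor and are therefore killed or kept together.\<close>

lemma kill_lm:
  assumes "l \<in> letters" "v \<in> words"
  shows "kill J (lm l v) = (if fst l \<in> J then kill J v else lm l (kill J v))"
proof -
  obtain i g where l: "l = (i, g)" and i: "i \<in> I" "g \<in> carrier (G i)" using assms by auto
  interpret group "G i" using grp i by auto
  show ?thesis
  proof (cases v)
    case Nil then show ?thesis using l by (auto simp: kill_Cons)
  next
    case (Cons b t)
    obtain j h where b: "b = (j, h)" by force
    have t: "kill J t \<in> words"
      using assms Cons b by (intro kill_closed letters_if_words) (auto simp: words_Cons)
    show ?thesis
    proof (cases "g = \<one>\<^bsub>G i\<^esub> \<or> i \<noteq> j")
      case True then show ?thesis using Cons b l by (auto simp: kill_Cons)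
    next
      case False
      have "lm (i, g \<otimes>\<^bsub>G i\<^esub> h) (kill J t) = lm (i, g) (lm (i, h) (kill J t))"
        using False t assms Cons b i by (intro lm_mult) (auto simp: words_Cons)
      then show ?thesis using False Cons b l by (auto simp: kill_Cons lm_one[of i])
    qed
  qed
qed

lemma kill_mult:
  assumes "set u \<subseteq> letters" "w \<in> words"
  shows "kill J (foldr lm u w) = foldr lm (kill J u) (kill J w)"
  using assms
proof (induction u)
  case (Cons l u)
  then show ?case
    by (auto simp: kill_lm kill_Cons foldr_closed foldr_lm kill_closed letters_if_words)
qed simp

lemma kill_hom: "kill J \<in> hom (free_product I G) (free_product I G)"
  by (auto simp: hom_def free_product_def kill_closed letters_if_words kill_mult)

lemma kill_id: "w \<in> words \<Longrightarrow> support w \<inter> J = {} \<Longrightarrow> kill J w = w"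
proof -
  assume w: "w \<in> words" "support w \<inter> J = {}"
  then have "filter (\<lambda>l. fst l \<notin> J) w = w" by (auto simp: filter_id_conv support_def)
  then show ?thesis using foldr_append_reduced[of w "[]"] w by (simp add: kill_def)
qed

text \<open>This allows small sets found at different points to be merged: whatever
  \<open>kill J\<close> trivialises, \<open>kill J'\<close> trivialises too.\<close>

lemma kill_kill:
  assumes "J \<subseteq> J'" "set w \<subseteq> letters" shows "kill J' (kill J w) = kill J' w"
  using assms
proof (induction w)
  case (Cons l w)
  then show ?case by (auto simp: kill_Cons kill_lm kill_closed)
qed simp

text \<open>Supplies the two brackets of the next proof: conjugating inside the free product of the
  factors in \<open>S\<close> neither leaves it nor trivialises \<open>c\<close>.\<close>

lemma support_conj:
  assumes "v \<in> words" "c \<in> words" "c \<noteq> []" "support v \<subseteq> S" "support c \<subseteq> S"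
  defines "c' \<equiv> foldr lm v (foldr lm c (word_inv v))"
  shows "c' \<in> words" "c' \<noteq> []" "support c' \<subseteq> S"
proof -
  show "c' \<in> words" unfolding c'_def using assms
    by (intro foldr_closed letters_if_words word_inv_closed)
  show "support c' \<subseteq> S"
    using support_mult[of v "foldr lm c (word_inv v)"] support_mult[of c "word_inv v"] assms
    by (auto simp: c'_def)
  show "c' \<noteq> []"
  proof
    assume "c' = []"
    then have "foldr lm v (foldr lm c (inv\<^bsub>free_product I G\<^esub> v)) = []"
      using assms by (simp add: F_inv)
    then have "foldr lm c (inv\<^bsub>free_product I G\<^esub> v) = inv\<^bsub>free_product I G\<^esub> v"
      using assms by (metis F.inv_closed F.inv_equality F.inv_inv F.m_closed)
    then show False using assms
      by (metis F.inv_closed F.r_cancel_one')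
  qed
qed

text \<open>Write \<open>x = p q v\<close> with \<open>v\<close> the longest suffix of \<open>x\<close> over the factors of \<open>c\<close> and \<open>p\<close> the
  longest prefix of the rest over the factors of \<open>d\<close>. Then
  \<open>p q (v c v\<inverse>) q\<inverse> (p\<inverse> d p) q v\<close> is reduced up to evaluating the brackets, which remain
  nontrivial; if \<open>q\<close> is empty this uses that \<open>c\<close> and \<open>d\<close> have no factor in common.\<close>

lemma conj_word_longer:
  assumes x: "x \<in> words" and c: "c \<in> words" "c \<noteq> []" and d: "d \<in> words" "d \<noteq> []"
    and disj: "support c \<inter> support d = {}"
  shows "length x < length (foldr lm x (foldr lm c (foldr lm (word_inv x) (foldr lm d x))))"
proof -
  define S where "S = support c"
  define T where "T = support d"
  have ST: "S \<inter> T = {}" using disj by (simp add: S_def T_def)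
  define v where "v = rev (takeWhile (\<lambda>l. fst l \<in> S) (rev x))"
  define u where "u = rev (dropWhile (\<lambda>l. fst l \<in> S) (rev x))"
  define p where "p = takeWhile (\<lambda>l. fst l \<in> T) u"
  define q where "q = dropWhile (\<lambda>l. fst l \<in> T) u"
  have u: "u = p @ q" by (simp add: p_def q_def)
  have x_eq: "x = p @ q @ v"
    using u unfolding u_def v_def
    by (metis append.assoc rev_append rev_rev_ident takeWhile_dropWhile_id)
  have pqv: "p \<in> words" "q \<in> words" "v \<in> words" and pqv': "p @ q @ v \<in> words" "q @ v \<in> words"
    using x unfolding x_eq by (auto simp: words_append)
  have sv: "support v \<subseteq> S" and sp: "support p \<subseteq> T"
    by (auto simp: support_def v_def p_def dest: set_takeWhileD)
  have last_u: "u \<noteq> [] \<Longrightarrow> fst (last u) \<notin> S"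
    unfolding u_def by (metis hd_dropWhile last_rev rev_is_Nil_conv)
  have hd_q: "q \<noteq> [] \<Longrightarrow> fst (hd q) \<notin> T"
    unfolding q_def using hd_dropWhile by blast
  define c' where "c' = foldr lm v (foldr lm c (word_inv v))"
  \<comment> \<open>The double inverse makes this an instance of \<open>support_conj\<close> with
    conjugator \<open>word_inv p\<close>; \<open>inv_inv\<close> removes it later.\<close>
  define d' where "d' = foldr lm (word_inv p) (foldr lm d (word_inv (word_inv p)))"
  have c': "c' \<in> words" "c' \<noteq> []" "support c' \<subseteq> S"
    unfolding c'_def using support_conj[of v c S] pqv c sv by (auto simp: S_def)
  have d': "d' \<in> words" "d' \<noteq> []" "support d' \<subseteq> T"
    unfolding d'_def using support_conj[of "word_inv p" d T] pqv d sp
    by (auto simp: T_def word_inv_closed)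
  have inv_inv: "word_inv (word_inv p) = p"
    using pqv by (metis F.inv_inv F_inv word_inv_closed)
  have hds: "fst (hd c') \<in> S" "fst (last c') \<in> S" "fst (hd d') \<in> T" "fst (last d') \<in> T"
    using c' d' hd_in_set last_in_set by (fastforce simp: support_def)+
  have v_hd: "v \<noteq> [] \<Longrightarrow> fst (hd v) \<in> S"
    using sv hd_in_set by (fastforce simp: support_def)
  \<comment> \<open>Neighbouring factors differ at every junction: \<open>c'\<close> lives on
    \<open>S\<close> and \<open>d'\<close> on \<open>T\<close>, while \<open>q\<close> ends outside
    \<open>S\<close> and begins outside \<open>T\<close>. For empty \<open>q\<close>, it is
    \<open>p\<close> that ends outside \<open>S\<close>, and disjointness of \<open>S\<close> and
    \<open>T\<close> separates \<open>c'\<close>, \<open>d'\<close> and \<open>v\<close>.\<close>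
  have red: "p @ q @ c' @ word_inv q @ d' @ q @ v \<in> words"
  proof (cases "q = []")
    case True
    then have "p \<noteq> [] \<Longrightarrow> fst (last p) \<notin> S" using last_u u by auto
    then show ?thesis
      using True c' d' pqv hds v_hd ST
      by (auto simp: words_append word_inv_def)
  next
    case False
    have iq: "word_inv q \<in> words" "word_inv q \<noteq> []" "fst (hd (word_inv q)) = fst (last q)"
      "fst (last (word_inv q)) = fst (hd q)"
      using word_inv_closed[OF pqv(2)] False
      by (auto simp: word_inv_def hd_rev last_rev last_map hd_map case_prod_unfold)
    have "fst (last q) \<notin> S" using last_u u False by auto
    then show ?thesis using iq False c' d' pqv pqv' hds hd_q
      by (auto simp: words_append)
  qed
  have mult_app: "foldr lm a b = a @ b" if "a @ b \<in> words" for a b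
    using that by (rule foldr_append_reduced)
  let ?m = "foldr lm"
  have r: "a @ b \<in> words \<Longrightarrow> b \<in> words" for a b by (simp add: words_append)
  have iq: "word_inv q \<in> words" and iv: "word_inv v \<in> words" and ip: "word_inv p \<in> words"
    using pqv by (simp_all add: word_inv_closed)
  have e: "p @ q @ c' @ word_inv q @ d' @ q @ v =
      ?m p (?m q (?m c' (?m (word_inv q) (?m d' (?m q v)))))"
    using red by (metis mult_app r)
  have x': "x = ?m p (?m q v)"
    using pqv' x_eq by (metis mult_app)
  have xi: "word_inv x = ?m (word_inv v) (?m (word_inv q) (word_inv p))"
    using F.inv_mult_group pqv iq iv ip x F.m_assoc
    by (metis F.m_closed F_inv x')
  have can: "?m (word_inv v) (?m v y) = y" "?m p (?m (word_inv p) y) = y" 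
    "?m (word_inv p) (?m p y) = y" if "y \<in> words" for y
    using that pqv F.r_inv F.l_inv F.m_assoc F_inv
    by (metis F.inv_closed F.l_one)+
  have "?m x (?m c (?m (word_inv x) (?m d x))) = p @ q @ c' @ word_inv q @ d' @ q @ v"
    unfolding e unfolding x' xi[unfolded x'] c'_def d'_def inv_inv
    using pqv c d iq iv ip by (simp add: F.m_assoc can)
  moreover have "length x < length (p @ q @ c' @ word_inv q @ d' @ q @ v)"
    using c' d' unfolding x_eq by (cases c') auto
  ultimately show ?thesis by simp
qed

end

subsection \<open>The fundamental groupoid\<close>

text \<open>By convexity of the unit interval, \<open>f\<close> and \<open>g\<close> are homotopic
  along straight lines, and \<open>p\<close> carries this homotopy to \<open>X\<close>. The unit,
  inverse and subdivision laws below are instances with piecewise linear \<open>f\<close> and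
  \<open>g\<close>.\<close>

lemma homotopic_paths_compose_interval:
  fixes p :: "real \<Rightarrow> 'a::topological_space"
  assumes p: "path p" "path_image p \<subseteq> X"
    and f: "path f" "path_image f \<subseteq> {0..1}" and g: "path g" "path_image g \<subseteq> {0..1}"
    and ends: "pathstart f = pathstart g" "pathfinish f = pathfinish g"
  shows "homotopic_paths X (p \<circ> f) (p \<circ> g)"
proof (rule homotopic_paths_continuous_image)
  show "homotopic_paths {0..1} f g"
  proof (rule homotopic_paths_linear)
    fix t :: real assume "t \<in> {0..1}"
    then have "f t \<in> {0..1}" "g t \<in> {0..1}" using f(2) g(2) unfolding path_image_def by blast+
    then show "closed_segment (f t) (g t) \<subseteq> {0..1}"
      by (intro closed_segment_subset) auto
  qed (use f g ends in auto)
  show "continuous_on {0..1} p" using p by (simp add: path_def)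
  show "p \<in> {0..1} \<rightarrow> X" using p by (auto simp: path_image_def)
qed

lemma homotopic_paths_rid_const:
  assumes "path p" "path_image p \<subseteq> X" "x = pathfinish p"
  shows "homotopic_paths X (p +++ (\<lambda>_. x)) p"
proof -
  have "homotopic_paths X (p \<circ> (linepath 0 1 +++ linepath 1 1)) (p \<circ> linepath 0 1)"
    using assms by (intro homotopic_paths_compose_interval) (auto simp: path_image_join closed_segment_eq_real_ivl)
  moreover have "p \<circ> linepath 0 1 = p" by (auto simp: linepath_def)
  moreover have "p \<circ> linepath 1 1 = (\<lambda>_. x)" using assms by (auto simp: linepath_def pathfinish_def)
  ultimately show ?thesis by (simp add: path_compose_join)
qed

lemma homotopic_paths_lid_const:
  assumes "path p" "path_image p \<subseteq> X" "x = pathstart p"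
  shows "homotopic_paths X ((\<lambda>_. x) +++ p) p"
proof -
  have "homotopic_paths X (p \<circ> (linepath 0 0 +++ linepath 0 1)) (p \<circ> linepath 0 1)"
    using assms by (intro homotopic_paths_compose_interval) (auto simp: path_image_join closed_segment_eq_real_ivl)
  moreover have "p \<circ> linepath 0 1 = p" by (auto simp: linepath_def)
  moreover have "p \<circ> linepath 0 0 = (\<lambda>_. x)" using assms by (auto simp: linepath_def pathstart_def)
  ultimately show ?thesis by (simp add: path_compose_join)
qed

lemma homotopic_paths_linv_const:
  assumes "path p" "path_image p \<subseteq> X" "x = pathfinish p"
  shows "homotopic_paths X (reversepath p +++ p) (\<lambda>_. x)"
proof -
  have "homotopic_paths X (p \<circ> (linepath 1 0 +++ linepath 0 1)) (p \<circ> linepath 1 1)"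
    using assms by (intro homotopic_paths_compose_interval)
      (auto simp: path_image_join closed_segment_eq_real_ivl)
  moreover have "p \<circ> linepath 0 1 = p" by (auto simp: linepath_def)
  moreover have "p \<circ> linepath 1 0 = reversepath p" by (auto simp: linepath_def reversepath_def)
  moreover have "p \<circ> linepath 1 1 = (\<lambda>_. x)" using assms by (auto simp: linepath_def pathfinish_def)
  ultimately show ?thesis by (simp add: path_compose_join)
qed

lemma path_const [simp]: "path (\<lambda>_. x)" "path_image (\<lambda>_. x) = {x}"
  "pathstart (\<lambda>_. x) = x" "pathfinish (\<lambda>_. x) = x"
  by (auto simp: path_def path_image_def pathstart_def pathfinish_def)

text \<open>A functor from the fundamental groupoid of \<open>X\<close> to the group
  \<open>K\<close>, described on representing paths. It evaluates loops at different base points in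
  one and the same group.\<close>

locale path_functor = group K for K (structure) +
  fixes X :: "'a::metric_space set" and \<Phi> :: "(real \<Rightarrow> 'a) \<Rightarrow> 'b"
  assumes closed [simp]: "path p \<Longrightarrow> path_image p \<subseteq> X \<Longrightarrow> \<Phi> p \<in> carrier K"
    and homotopic: "homotopic_paths X p q \<Longrightarrow> \<Phi> p = \<Phi> q"
    and join: "path p \<Longrightarrow> path_image p \<subseteq> X \<Longrightarrow> path q \<Longrightarrow> path_image q \<subseteq> X \<Longrightarrow>
      pathfinish p = pathstart q \<Longrightarrow> \<Phi> (p +++ q) = \<Phi> p \<otimes> \<Phi> q"
begin

lemma const [simp]: "x \<in> X \<Longrightarrow> \<Phi> (\<lambda>_. x) = \<one>"
proof -
  assume x: "x \<in> X"
  have "(\<lambda>_. x) +++ (\<lambda>_. x) = (\<lambda>_::real. x)" by (auto simp: joinpaths_def)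
  then have "\<Phi> (\<lambda>_. x) \<otimes> \<Phi> (\<lambda>_. x) = \<Phi> (\<lambda>_. x)"
    using join[of "\<lambda>_. x" "\<lambda>_. x"] x by simp
  then show ?thesis using x by simp
qed

lemma reverse:
  assumes "path p" "path_image p \<subseteq> X"
  shows "\<Phi> (reversepath p) = inv (\<Phi> p)"
proof -
  have "\<Phi> (reversepath p +++ p) = \<one>"
    using homotopic[OF homotopic_paths_linv_const[OF assms refl]] assms
    by (auto simp: pathfinish_in_path_image subset_iff)
  then show ?thesis using assms
    by (intro inv_equality[symmetric]) (simp_all add: join)
qed

text \<open>Used for the infinitely nested loops, whose recursion holds only on
  \<open>{0..1}\<close>.\<close>

lemma eq_on:
  assumes "path p" "path_image p \<subseteq> X" "\<And>t. t \<in> {0..1} \<Longrightarrow> p t = q t"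
  shows "\<Phi> p = \<Phi> q"
  using homotopic homotopic_paths_eq assms by blast

text \<open>The parameters may come in any order: backtracking along \<open>p\<close> is absorbed by
  the reparametrisation.\<close>

lemma subpath_join:
  assumes p: "path p" "path_image p \<subseteq> X" and "u \<in> {0..1}" "v \<in> {0..1}" "w \<in> {0..1}"
  shows "\<Phi> (p \<circ> linepath u w) = \<Phi> (p \<circ> linepath u v) \<otimes> \<Phi> (p \<circ> linepath v w)"
proof -
  have seg: "closed_segment a b \<subseteq> {0..1}" if "a \<in> {0..1}" "b \<in> {0..1}" for a b :: real
    using that by (intro closed_segment_subset) auto
  have pc: "path (p \<circ> linepath a b) \<and> path_image (p \<circ> linepath a b) \<subseteq> X"
    if "a \<in> {0..1}" "b \<in> {0..1}" for a b :: real
    using homotopic_paths_compose_interval[OF p, of "linepath a b" "linepath a b"] seg[OF that]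
    by simp
  have "homotopic_paths X (p \<circ> linepath u w) (p \<circ> (linepath u v +++ linepath v w))"
    using seg assms by (intro homotopic_paths_compose_interval) (auto simp: path_image_join)
  then show ?thesis
    using pc assms by (simp add: homotopic path_compose_join join pathfinish_compose pathstart_compose)
qed

lemma compose_hom:
  assumes "\<psi> \<in> hom K L" "group L"
  shows "path_functor L X (\<lambda>p. \<psi> (\<Phi> p))"
proof -
  interpret L: group L by fact
  show ?thesis
    using assms by unfold_locales (auto simp: hom_def join homotopic Pi_iff intro: homotopic arg_cong)
qed

end

section \<open>From homomorphisms on the fundamental group to functors on paths\<close>

lemma loop_homotopy_equiv: "equiv (loops_at X x) (loop_homotopy X x)"
  by (intro equivI refl_onI symI transI)
    (auto simp: loop_homotopy_def loops_at_def homotopic_paths_sym intro: homotopic_paths_trans)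

lemma loop_class_eq:
  assumes "homotopic_paths X p q" "p \<in> loops_at X x"
  shows "loop_homotopy X x `` {p} = loop_homotopy X x `` {q}"
proof -
  have "q \<in> loops_at X x"
    using assms homotopic_paths_imp_path[OF assms(1)] homotopic_paths_imp_subset[OF assms(1)]
      homotopic_paths_imp_pathstart[OF assms(1)] homotopic_paths_imp_pathfinish[OF assms(1)]
    by (simp add: loops_at_def)
  then have "(p, q) \<in> loop_homotopy X x" using assms by (simp add: loop_homotopy_def)
  then show ?thesis by (rule equiv_class_eq[OF loop_homotopy_equiv])
qed

lemma loops_at_join: "p \<in> loops_at X x \<Longrightarrow> q \<in> loops_at X x \<Longrightarrow> p +++ q \<in> loops_at X x"
  by (simp add: loops_at_def subset_path_image_join)

text \<open>The double union defining the product runs over representatives and collapses, since all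
  of them give the same class.\<close>

lemma fundamental_group_mult_class:
  assumes p: "p \<in> loops_at X x" and q: "q \<in> loops_at X x"
  shows "loop_homotopy X x `` {p} \<otimes>\<^bsub>fundamental_group X x\<^esub> loop_homotopy X x `` {q}
    = loop_homotopy X x `` {p +++ q}"
proof -
  have "loop_homotopy X x `` {p' +++ q'} = loop_homotopy X x `` {p +++ q}"
    if "(p, p') \<in> loop_homotopy X x" "(q, q') \<in> loop_homotopy X x" for p' q'
    using that loop_class_eq[of X "p +++ q" "p' +++ q'" x] loops_at_join[OF p q]
    by (auto simp: loop_homotopy_def loops_at_def homotopic_paths_join)
  moreover have "(p, p) \<in> loop_homotopy X x" "(q, q) \<in> loop_homotopy X x"
    using p q by (auto simp: loop_homotopy_def loops_at_def)
  ultimately have "(\<Union>p'\<in>loop_homotopy X x `` {p}. \<Union>q'\<in>loop_homotopy X x `` {q}.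
      loop_homotopy X x `` {p' +++ q'}) = loop_homotopy X x `` {p +++ q}"
    by blast
  then show ?thesis by (simp add: fundamental_group_def)
qed

text \<open>Every path is closed up to a loop at \<open>x\<^sub>0\<close> by chosen connecting paths
  \<open>\<gamma>\<close>, and \<open>h\<close> is applied to the class of that loop.\<close>

lemma path_functor_extending:
  fixes X :: "'a::metric_space set"
  assumes X: "path_connected X" "x\<^sub>0 \<in> X" and "group K"
    and h: "h \<in> hom (fundamental_group X x\<^sub>0) K"
  obtains \<Phi> where "path_functor K X \<Phi>"
    "\<And>p. p \<in> loops_at X x\<^sub>0 \<Longrightarrow> \<Phi> p = h (loop_homotopy X x\<^sub>0 `` {p})"
proof -
  interpret group K by fact
  define H where "H p = h (loop_homotopy X x\<^sub>0 `` {p})" for p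
  let ?L = "loops_at X x\<^sub>0"
  have cls: "loop_homotopy X x\<^sub>0 `` {p} \<in> carrier (fundamental_group X x\<^sub>0)" if "p \<in> ?L" for p
    using that by (auto simp: fundamental_group_def intro: quotientI)
  have H_closed: "H p \<in> carrier K" if "p \<in> ?L" for p
    using cls[OF that] h by (auto simp: H_def hom_def)
  have H_join: "H (p +++ q) = H p \<otimes>\<^bsub>K\<^esub> H q" if "p \<in> ?L" "q \<in> ?L" for p q
    using cls that h by (simp add: H_def hom_def flip: fundamental_group_mult_class)
  have H_homotopic: "H p = H q" if "homotopic_paths X p q" "p \<in> ?L" for p q
    using loop_class_eq[OF that] by (simp add: H_def)
  \<comment> \<open>The connecting path of the base point itself is taken constant, so that closing
    up a loop at \<open>x\<^sub>0\<close> adds only constant paths.\<close>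
  have "\<exists>g. path g \<and> path_image g \<subseteq> X \<and> pathstart g = x\<^sub>0 \<and> pathfinish g = y \<and>
      (y = x\<^sub>0 \<longrightarrow> g = (\<lambda>_. x\<^sub>0))" if "y \<in> X" for y
  proof (cases "y = x\<^sub>0")
    case True
    then show ?thesis using X by (intro exI[of _ "\<lambda>_. x\<^sub>0"]) auto
  next
    case False
    then show ?thesis using X that by (auto simp: path_connected_def)
  qed
  then obtain \<gamma> where \<gamma>: "\<And>y. y \<in> X \<Longrightarrow> path (\<gamma> y)" "\<And>y. y \<in> X \<Longrightarrow> path_image (\<gamma> y) \<subseteq> X"
    "\<And>y. y \<in> X \<Longrightarrow> pathstart (\<gamma> y) = x\<^sub>0" "\<And>y. y \<in> X \<Longrightarrow> pathfinish (\<gamma> y) = y"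
    and \<gamma>0: "\<gamma> x\<^sub>0 = (\<lambda>_. x\<^sub>0)"
    using X(2) by metis
  define E where "E p = (\<gamma> (pathstart p) +++ p) +++ reversepath (\<gamma> (pathfinish p))" for p
  have ends: "pathstart p \<in> X" "pathfinish p \<in> X" if "path_image p \<subseteq> X" for p
    using that by auto
  have E: "E p \<in> ?L" if "path p" "path_image p \<subseteq> X" for p
    using that \<gamma> ends[OF that(2)] by (auto simp: loops_at_def E_def path_image_join)
  have E_homotopic: "homotopic_paths X (E p) (E q)" if pq: "homotopic_paths X p q" for p q
  proof -
    have "path p" "path_image p \<subseteq> X" using pq homotopic_paths_imp_path homotopic_paths_imp_subset by blast+
    moreover have "pathstart p = pathstart q" "pathfinish p = pathfinish q"
      using pq homotopic_paths_imp_pathstart homotopic_paths_imp_pathfinish by blast+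
    ultimately show ?thesis unfolding E_def
      using pq \<gamma> ends[of p] by (intro homotopic_paths_join) auto
  qed
  \<comment> \<open>The connecting path at the common endpoint is run back and forth in the middle
    and cancels; the rest is reassociation.\<close>
  have E_join: "homotopic_paths X (E p +++ E q) (E (p +++ q))"
    if p: "path p" "path_image p \<subseteq> X" and q: "path q" "path_image q \<subseteq> X"
      and pq: "pathfinish p = pathstart q" for p q
  proof -
    let ?a = "\<gamma> (pathstart p)" and ?b = "\<gamma> (pathstart q)" and ?c = "reversepath (\<gamma> (pathfinish q))"
    let ?A = "?a +++ p" and ?B = "reversepath ?b"
    note e = ends[OF p(2)] ends[OF q(2)]
    have im: "path_image ?A \<subseteq> X" "path_image ?B \<subseteq> X" "path_image ?c \<subseteq> X" "path_image ?b \<subseteq> X" "path_image ?a \<subseteq> X"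
      "path ?A" "path ?B" "path ?c" "path ?b" "path ?a"
      using \<gamma> p q e by (auto simp: path_image_join)
    have joins: "pathfinish ?A = pathstart ?B" "pathfinish ?B = pathstart ?b"
      "pathfinish ?b = pathstart q" "pathfinish q = pathstart ?c" "pathfinish ?A = pathstart q"
      "pathfinish ?a = pathstart p"
      using \<gamma> e pq by auto
    note s = im joins p q pq
    have "homotopic_paths X ((?A +++ ?B) +++ (?b +++ q)) (?A +++ (?B +++ (?b +++ q)))"
      by (rule homotopic_paths_sym[OF homotopic_paths_assoc]) (use s in \<open>simp_all add: subset_path_image_join\<close>)
    also have "homotopic_paths X \<dots> (?A +++ ((?B +++ ?b) +++ q))"
      by (intro homotopic_paths_join homotopic_paths_assoc) (use s in \<open>simp_all add: subset_path_image_join\<close>)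
    also have "homotopic_paths X \<dots> (?A +++ ((\<lambda>_. pathfinish ?b) +++ q))"
      by (intro homotopic_paths_join homotopic_paths_linv_const) (use s in \<open>simp_all add: subset_path_image_join\<close>)
    also have "homotopic_paths X \<dots> (?A +++ q)"
      by (intro homotopic_paths_join homotopic_paths_lid_const) (use s in \<open>simp_all add: subset_path_image_join\<close>)
    also have "homotopic_paths X \<dots> (?a +++ (p +++ q))"
      by (rule homotopic_paths_sym[OF homotopic_paths_assoc]) (use s in \<open>simp_all add: subset_path_image_join\<close>)
    finally have 1: "homotopic_paths X ((?A +++ ?B) +++ (?b +++ q)) (?a +++ (p +++ q))" .
    have "homotopic_paths X ((?A +++ ?B) +++ ((?b +++ q) +++ ?c)) (((?A +++ ?B) +++ (?b +++ q)) +++ ?c)"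
      by (intro homotopic_paths_assoc) (use s in \<open>simp_all add: subset_path_image_join\<close>)
    also have "homotopic_paths X \<dots> ((?a +++ (p +++ q)) +++ ?c)"
      by (rule homotopic_paths_join[OF 1]) (use s in \<open>simp_all add: subset_path_image_join\<close>)
    finally show ?thesis using pq by (simp add: E_def)
  qed
  have E_loop: "homotopic_paths X (E p) p" if "p \<in> ?L" for p
  proof -
    have p: "path p" "path_image p \<subseteq> X" "pathstart p = x\<^sub>0" "pathfinish p = x\<^sub>0"
      using that by (auto simp: loops_at_def)
    have E_eq: "E p = ((\<lambda>_. x\<^sub>0) +++ p) +++ (\<lambda>_. x\<^sub>0)"
      using p by (simp add: E_def \<gamma>0) (simp add: reversepath_def)
    have "homotopic_paths X (((\<lambda>_. x\<^sub>0) +++ p) +++ (\<lambda>_. x\<^sub>0)) ((\<lambda>_. x\<^sub>0) +++ p)"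
      using p X by (intro homotopic_paths_rid_const) (auto simp: path_image_join)
    also have "homotopic_paths X \<dots> p"
      using p by (intro homotopic_paths_lid_const) auto
    finally show ?thesis by (simp add: E_eq)
  qed
  show thesis
  proof (rule that[of "\<lambda>p. H (E p)"])
    show "path_functor K X (\<lambda>p. H (E p))"
    proof
      fix p q :: "real \<Rightarrow> 'a"
      assume pq: "path p" "path_image p \<subseteq> X" "path q" "path_image q \<subseteq> X" "pathfinish p = pathstart q"
      then have "H (E p +++ E q) = H (E (p +++ q))"
        by (intro H_homotopic E_join loops_at_join E)
      then show "H (E (p +++ q)) = H (E p) \<otimes>\<^bsub>K\<^esub> H (E q)"
        using pq by (simp add: H_join E)
    next
      fix p q assume pq: "homotopic_paths X p q"
      then show "H (E p) = H (E q)"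
        by (intro H_homotopic E_homotopic E)
          (blast dest: homotopic_paths_imp_path homotopic_paths_imp_subset)+
    qed (auto intro: H_closed E)
    show "H (E p) = h (loop_homotopy X x\<^sub>0 `` {p})" if "p \<in> ?L" for p
      using H_homotopic[OF E_loop[OF that]] E that by (simp add: H_def loops_at_def)
  qed
qed

subsection \<open>Infinitely nested loops\<close>

text \<open>Realises the word \<open>x c x\<inverse> d x\<close> of \<open>conj_word_longer\<close>,
  bracketed as the product there.\<close>

definition nest :: "(real \<Rightarrow> 'a) \<Rightarrow> (real \<Rightarrow> 'a) \<Rightarrow> (real \<Rightarrow> 'a::topological_space) \<Rightarrow> real \<Rightarrow> 'a" where
  "nest c d f = f +++ (c +++ (reversepath f +++ (d +++ f)))"

text \<open>At each parameter, \<^term>\<open>nest c d f\<close> either copies \<open>f\<close> at a parameter independent of \<open>f\<close> or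
  ignores \<open>f\<close>. This is what makes the infinite nesting converge pointwise.\<close>

definition relabels :: "((real \<Rightarrow> 'a) \<Rightarrow> real \<Rightarrow> 'a) \<Rightarrow> bool" where
  "relabels P \<longleftrightarrow> (\<forall>t\<in>{0..1}. (\<exists>s\<in>{0..1}. \<forall>f. P f t = f s) \<or> (\<exists>y. \<forall>f. P f t = y))"

lemma relabels_join:
  assumes "relabels P" "relabels Q" shows "relabels (\<lambda>f. P f +++ Q f)"
  unfolding relabels_def
proof
  fix t :: real assume t: "t \<in> {0..1}"
  show "(\<exists>s\<in>{0..1}. \<forall>f. (P f +++ Q f) t = f s) \<or> (\<exists>y. \<forall>f. (P f +++ Q f) t = y)"
  proof (cases "t \<le> 1/2")
    case True
    then show ?thesis using t assms(1) unfolding relabels_def joinpaths_def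
      by (auto dest!: bspec[of _ _ "2 * t"])
  next
    case False
    then show ?thesis using t assms(2) unfolding relabels_def joinpaths_def
      by (auto dest!: bspec[of _ _ "2 * t - 1"])
  qed
qed

lemma relabels_nest: "relabels (nest c d)"
proof -
  have "relabels (\<lambda>f. f)" "relabels (\<lambda>_. c)" "relabels (\<lambda>_. d)"
    unfolding relabels_def by auto
  moreover have "relabels reversepath"
    unfolding relabels_def reversepath_def by (auto intro!: bexI[of _ "1 - _"])
  ultimately have "relabels (\<lambda>f. f +++ (c +++ (reversepath f +++ (d +++ f))))"
    by (intro relabels_join)
  then show ?thesis unfolding nest_def[abs_def] .
qed

lemma nest_loop:
  "c \<in> loops_at S x \<Longrightarrow> d \<in> loops_at S x \<Longrightarrow> f \<in> loops_at S x \<Longrightarrow> nest c d f \<in> loops_at S x"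
  unfolding nest_def by (intro loops_at_join) (simp_all add: loops_at_def)

text \<open>The solution is the limit of the finite nestings with the constant path innermost. At
  each parameter either some depth fixes the value, whatever stands innermost, or the value is
  \<open>x\<close>. The limit is uniform because the loops of level \<open>n\<close> stay within
  \<open>1 / Suc n\<close> of \<open>x\<close>.\<close>

lemma infinitely_nested_loops:
  fixes X :: "'a::metric_space set"
  assumes c: "\<And>n. c n \<in> loops_at (X \<inter> ball x (1 / Suc n)) x"
    and d: "\<And>n. d n \<in> loops_at (X \<inter> ball x (1 / Suc n)) x"
  obtains w where "\<And>n. w n \<in> loops_at X x"
    "\<And>n t. t \<in> {0..1} \<Longrightarrow> nest (c n) (d n) (w (Suc n)) t = w n t"
proof -
  define P where "P n = nest (c n) (d n)" for n
  define S where "S n = X \<inter> ball x (1 / Suc n)" for n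
  have xX: "x \<in> X" using c[of 0] pathstart_in_path_image[of "c 0"] by (auto simp: loops_at_def)
  have relab: "relabels (P n)" for n unfolding P_def by (rule relabels_nest)
  have S_Suc: "loops_at (S (Suc n)) x \<subseteq> loops_at (S n) x" for n
  proof -
    have "1 / real (Suc (Suc n)) \<le> 1 / real (Suc n)" by (simp add: field_simps)
    then show ?thesis by (auto simp: loops_at_def S_def subset_iff)
  qed
  have P_loop: "P n f \<in> loops_at (S n) x" if "f \<in> loops_at (S (Suc n)) x" for n f
    unfolding P_def using that c d S_Suc by (intro nest_loop) (auto simp: S_def)
  \<comment> \<open>\<open>Q k n f\<close> nests the \<open>k\<close> levels \<open>P n\<close>,
    ..., \<open>P (n + k - 1)\<close> around \<open>f\<close>; \<open>QSuc\<close> peels off the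
    outermost level and \<open>Q_inner\<close> the innermost.\<close>
  define Q where "Q = rec_nat (\<lambda>n f. f) (\<lambda>k Qk n f. P n (Qk (Suc n) f))"
  have Q0: "Q 0 n f = f" and QSuc: "Q (Suc k) n f = P n (Q k (Suc n) f)" for k n f
    by (simp_all add: Q_def)
  have Q_inner: "Q (Suc k) n f = Q k n (P (n + k) f)" for k n f
    by (induction k arbitrary: n) (simp_all add: Q0 QSuc)
  define A where "A k n = Q k n (\<lambda>_. x)" for k n
  have A_loop: "A k n \<in> loops_at (S n) x" for k n
    unfolding A_def
  proof (induction k arbitrary: n)
    case 0
    then show ?case using xX by (auto simp: Q0 loops_at_def S_def)
  next
    case (Suc k)
    then show ?case by (simp add: QSuc P_loop)
  qed
  have stable: "Q (k + m) n f t = y" if "\<And>f. Q k n f t = y" for k m n f t y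
    using that by (induction m arbitrary: f) (simp_all add: Q_inner)
  define det where "det n t y \<longleftrightarrow> (\<exists>k. \<forall>f. Q k n f t = y)" for n t y
  have det_unique: "y = y'" if det: "det n t y" "det n t y'" for n t y y'
  proof -
    obtain k k' where k: "\<forall>f. Q k n f t = y" "\<forall>f. Q k' n f t = y'"
      using det unfolding det_def by blast
    \<comment> \<open>Both values are compared at depth \<open>k + k'\<close>, where the innermost
      path no longer matters, so \<open>undefined\<close> can stand for it.\<close>
    show ?thesis
      using stable[of k n t y k' undefined] stable[of k' n t y' k undefined] k by (simp add: add.commute)
  qed
  \<comment> \<open>Where no depth fixes the value, the parameter is handed down through all levels,
    so the default must be the point \<open>x\<close> to which the loops shrink.\<close>
  define w where "w n t = (if \<exists>y. det n t y then THE y. det n t y else x)" for n t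
  have w_det: "w n t = y" if "det n t y" for n t y
    unfolding w_def using that det_unique by (auto intro!: the_equality)
  have w_undet: "w n t = x" if "\<nexists>y. det n t y" for n t
    using that by (simp add: w_def)
  have w_step: "w n t = P n (w (Suc n)) t" if t: "t \<in> {0..1}" for n t
  proof -
    consider s where "s \<in> {0..1}" "\<And>f. P n f t = f s" | y where "\<And>f. P n f t = y"
      using relab[of n] t unfolding relabels_def by blast
    then show ?thesis
    proof cases
      case 1
      \<comment> \<open>Since \<open>P n\<close> copies its argument at \<open>s\<close>, parameter
        \<open>t\<close> at level \<open>n\<close> and \<open>s\<close> at level
        \<open>Suc n\<close> are fixed with the same value or both get the default; the depths
        differ by one.\<close>
      have "det n t y \<longleftrightarrow> det (Suc n) s y" for y
      proof
        assume "det n t y"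
        then obtain k where "\<And>f. Q k n f t = y" unfolding det_def by blast
        then have "Q (Suc k) n f t = y" for f using stable[of k n t y 1 f] by simp
        then show "det (Suc n) s y" by (auto simp: det_def QSuc 1)
      next
        assume "det (Suc n) s y"
        then obtain k where "\<And>f. Q k (Suc n) f s = y" unfolding det_def by blast
        then have "Q (Suc k) n f t = y" for f by (simp add: QSuc 1)
        then show "det n t y" by (auto simp: det_def)
      qed
      then have "det n t = det (Suc n) s" by (intro ext)
      then show ?thesis by (simp add: 1 w_def)
    next
      case 2
      then have "Q (Suc 0) n f t = y" for f by (simp add: QSuc)
      then have "det n t y" unfolding det_def by blast
      then show ?thesis by (simp add: 2 w_det)
    qed
  qed
  have w_cases: "w n t = x \<or> (\<exists>k. w n t = A k n t)" for n t
    using w_det w_undet unfolding det_def A_def by metis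
  have w_S: "w n t \<in> S n" if "t \<in> {0..1}" for n t
  proof -
    have "x \<in> S n" using xX by (simp add: S_def)
    moreover have "A k n t \<in> S n" for k
      using A_loop[of k n] that by (auto simp: loops_at_def path_image_def)
    ultimately show ?thesis using w_cases[of n t] by metis
  qed
  \<comment> \<open>Either the outer level ignores its argument and the values agree, or both sides
    move to the same parameter of level \<open>Suc n\<close>. After \<open>k\<close> moves the
    constant path is compared with \<open>w (n + k)\<close>, which is within
    \<open>1 / (n + k + 1)\<close> of \<open>x\<close>.\<close>
  have near: "dist (A k n t) (w n t) \<le> 1 / (n + k + 1)" if "t \<in> {0..1}" for k n t
    using that
  proof (induction k arbitrary: n t)
    case 0
    then show ?case using w_S[of t n] by (simp add: A_def Q0 S_def less_imp_le add.commute)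
  next
    case (Suc k)
    consider s where "s \<in> {0..1}" "\<And>f. P n f t = f s" | y where "\<And>f. P n f t = y"
      using relab[of n] Suc.prems unfolding relabels_def by blast
    then show ?case
    proof cases
      case 1
      then show ?thesis using Suc.IH[of s "Suc n"] Suc.prems
        by (simp add: A_def QSuc w_step add_ac)
    next
      case 2
      then show ?thesis using Suc.prems by (simp add: A_def QSuc w_step)
    qed
  qed
  have "continuous_on {0..1} (w n)" for n
  proof (rule uniform_limit_theorem)
    show "\<forall>\<^sub>F k in sequentially. continuous_on {0..1} (A k n)"
      using A_loop by (auto simp: loops_at_def path_def)
    show "uniform_limit {0..1} (\<lambda>k. A k n) (w n) sequentially"
    proof (rule uniform_limitI)
      fix e :: real assume "e > 0"
      then obtain N where N: "1 / real (Suc N) < e" using nat_approx_posE by blast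
      show "\<forall>\<^sub>F k in sequentially. \<forall>t\<in>{0..1}. dist (A k n t) (w n t) < e"
        unfolding eventually_sequentially
      proof (intro exI[of _ N] allI impI ballI)
        fix k and t :: real assume k: "N \<le> k" and t: "t \<in> {0..1}"
        have "1 / (real n + real k + 1) \<le> 1 / real (Suc N)"
          using k by (intro divide_left_mono) auto
        then show "dist (A k n t) (w n t) < e" using near[OF t, of k n] N by linarith
      qed
    qed
  qed auto
  moreover have "w n t = x" if "t = 0 \<or> t = 1" for n t
  proof -
    have "A k n t = x" for k
      using A_loop[of k n] that by (auto simp: loops_at_def pathstart_def pathfinish_def)
    then show ?thesis using w_cases[of n t] by metis
  qed
  moreover have "path_image (w n) \<subseteq> X" for n
    using w_S[of _ n] unfolding path_image_def S_def by blast
  ultimately have wl: "w n \<in> loops_at X x" for n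
    by (simp add: loops_at_def path_def pathstart_def pathfinish_def)
  have "nest (c n) (d n) (w (Suc n)) t = w n t" if "t \<in> {0..1}" for n t
    using w_step[OF that, of n] unfolding P_def by (rule sym)
  then show thesis
    by (intro that[of w] wl)
qed

subsection \<open>Cardinality of the set of factors\<close>

lemma countable_ordLeq_Cinfinite:
  assumes "Cinfinite \<kappa>" "countable J" shows "|J| \<le>o \<kappa>"
  using assms natLeq_ordLeq_cinfinite countable_card_le_natLeq ordLeq_transitive by blast

text \<open>A form of the \<open>\<Delta>\<close>-system lemma: \<open>R\<close> is a largest finite set that is contained in
  the supports, of size at most \<open>m\<close>, of a large subfamily.\<close>

lemma large_family_finite_kernel:
  fixes supp :: "'w \<Rightarrow> 'i set" and P :: "'i set \<Rightarrow> 'w \<Rightarrow> bool"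
  assumes \<kappa>: "Cinfinite \<kappa>"
    and fin: "\<And>w. w \<in> H \<Longrightarrow> finite (supp w)"
    and antimono: "\<And>J J' w. w \<in> H \<Longrightarrow> J \<subseteq> J' \<Longrightarrow> P J' w \<Longrightarrow> P J w"
    and large: "\<And>J. |J| \<le>o \<kappa> \<Longrightarrow> \<exists>w\<in>H. P J w"
  obtains R where "finite R" "\<And>J. |J| \<le>o \<kappa> \<Longrightarrow> \<exists>w\<in>H. P J w \<and> supp w \<inter> J \<subseteq> R"
proof -
  define B where "B m R \<longleftrightarrow> finite R \<and>
    (\<forall>J. |J| \<le>o \<kappa> \<longrightarrow> (\<exists>w\<in>H. P J w \<and> R \<subseteq> supp w \<and> card (supp w) \<le> m))" for m R
  \<comment> \<open>If every \<open>m\<close> failed, the countable union of the small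
    counterexamples \<open>J m\<close> would still be small. A \<open>w\<close> that satisfies
    \<open>P\<close> for this union refutes the one with \<open>m = card (supp w)\<close>.\<close>
  have "\<exists>m. B m {}"
  proof (rule ccontr)
    assume "\<nexists>m. B m {}"
    then have "\<forall>m. \<exists>J. |J| \<le>o \<kappa> \<and> \<not> (\<exists>w\<in>H. P J w \<and> card (supp w) \<le> m)"
      by (simp add: B_def)
    then obtain J where J: "\<And>m. |J m| \<le>o \<kappa>" "\<And>m w. w \<in> H \<Longrightarrow> P (J m) w \<Longrightarrow> \<not> card (supp w) \<le> m"
      by metis
    have "|\<Union>m\<in>UNIV. J m| \<le>o \<kappa>"
      using J(1) \<kappa> by (intro UNION_Cinfinite_bound) (auto intro: countable_ordLeq_Cinfinite)
    then obtain w where w: "w \<in> H" "P (\<Union>m\<in>UNIV. J m) w" using large by blast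
    have "P (J (card (supp w))) w" by (rule antimono[OF w(1) _ w(2)]) auto
    then show False using J(2) w by blast
  qed
  then obtain m where m: "B m {}" ..
  have bound: "card R \<le> m" if "B m R" for R
  proof -
    have "|{}::'i set| \<le>o \<kappa>" using \<kappa> by (simp add: countable_ordLeq_Cinfinite)
    then obtain w where w: "w \<in> H" "R \<subseteq> supp w" "card (supp w) \<le> m"
      using \<open>B m R\<close> unfolding B_def by blast
    then have "card R \<le> card (supp w)" by (intro card_mono fin)
    then show ?thesis using w by simp
  qed
  obtain R where R: "B m R" and R_max: "\<And>R'. B m R' \<Longrightarrow> card R' \<le> card R"
    using ex_has_greatest_nat[of "B m" "{}" card "Suc m"] m bound by (metis le_imp_less_Suc)
  \<comment> \<open>By maximality each \<open>i\<close> in \<open>J - R\<close> has a small set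
    \<open>F i\<close> witnessing that \<open>insert i R\<close> fails. Enlarging \<open>J\<close>
    by all of these keeps it small and forces every such \<open>i\<close> out of the
    support.\<close>
  have kernel: "\<exists>w\<in>H. P J w \<and> supp w \<inter> J \<subseteq> R" if J: "|J| \<le>o \<kappa>" for J
  proof -
    have "\<not> B m (insert i R)" if "i \<notin> R" for i
    proof
      assume "B m (insert i R)"
      then have "card (insert i R) \<le> card R" by (rule R_max)
      moreover have "finite R" using R by (simp add: B_def)
      ultimately show False using that by simp
    qed
    then have "\<forall>i\<in>J - R. \<exists>J'. |J'| \<le>o \<kappa> \<and>
        \<not> (\<exists>w\<in>H. P J' w \<and> insert i R \<subseteq> supp w \<and> card (supp w) \<le> m)"
      using R unfolding B_def by blast
    then obtain F where F: "\<And>i. i \<in> J - R \<Longrightarrow> |F i| \<le>o \<kappa>"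
      "\<And>i w. i \<in> J - R \<Longrightarrow> w \<in> H \<Longrightarrow> P (F i) w \<Longrightarrow> insert i R \<subseteq> supp w \<Longrightarrow> \<not> card (supp w) \<le> m"
      by metis
    have "|J - R| \<le>o \<kappa>" by (rule ordLeq_transitive[OF card_of_mono1 J]) blast
    then have "|J \<union> (\<Union>i\<in>J - R. F i)| \<le>o \<kappa>"
      using F(1) J \<kappa> by (intro Un_Cinfinite_bound UNION_Cinfinite_bound) auto
    then obtain w where w: "w \<in> H" "P (J \<union> (\<Union>i\<in>J - R. F i)) w" "R \<subseteq> supp w" "card (supp w) \<le> m"
      using R unfolding B_def by blast
    have "i \<notin> supp w" if "i \<in> J - R" for i
    proof -
      have "P (F i) w" by (rule antimono[OF w(1) _ w(2)]) (use that in auto)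
      then show ?thesis using F(2)[OF that w(1)] w by blast
    qed
    moreover have "P J w" by (rule antimono[OF w(1) _ w(2)]) auto
    ultimately show ?thesis using w(1) by blast
  qed
  have "finite R" using R by (simp add: B_def)
  then show thesis using kernel by (rule that)
qed

section \<open>Generators for the image of the fundamental group\<close>

context path_functor
begin

text \<open>Going from \<open>z\<close> along \<open>s\<close> and \<open>p\<close> and returning
  along \<open>q\<close> and \<open>s\<close> is a loop in \<open>W\<close>; its value is trivial,
  and \<open>\<Phi> s\<close> cancels.\<close>

lemma eq_if_loops_trivial:
  assumes W: "path_connected W" "W \<subseteq> X" "z \<in> W"
    and triv: "\<And>p. p \<in> loops_at W z \<Longrightarrow> \<Phi> p = \<one>"
    and p: "path p" "path_image p \<subseteq> W" and q: "path q" "path_image q \<subseteq> W"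
    and ends: "pathstart p = pathstart q" "pathfinish p = pathfinish q"
  shows "\<Phi> p = \<Phi> q"
proof -
  have "pathstart p \<in> W" using p(2) pathstart_in_path_image by blast
  then obtain s where s: "path s" "path_image s \<subseteq> W" "pathstart s = z" "pathfinish s = pathstart p"
    using W unfolding path_connected_def by metis
  have im: "path_image p \<subseteq> X" "path_image q \<subseteq> X" "path_image s \<subseteq> X"
    using p q s W by auto
  have "(s +++ p) +++ reversepath (s +++ q) \<in> loops_at W z"
    using p q s ends by (simp add: loops_at_def subset_path_image_join)
  then have "\<Phi> ((s +++ p) +++ reversepath (s +++ q)) = \<one>" by (rule triv)
  moreover have "\<Phi> ((s +++ p) +++ reversepath (s +++ q)) = (\<Phi> s \<otimes> \<Phi> p) \<otimes> inv (\<Phi> s \<otimes> \<Phi> q)"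
    using p q s ends im by (simp add: join reverse subset_path_image_join)
  ultimately have "\<Phi> s \<otimes> \<Phi> p = \<Phi> s \<otimes> \<Phi> q"
    using p q s im by (metis closed m_closed inv_equality inv_inv inv_closed)
  then show ?thesis using p q s im by simp
qed

text \<open>Each pair of intersecting members contributes one edge generator, since by
  \<open>same\<close> the path between their centres is immaterial. A loop is followed through the
  cover and decomposes into such edges.\<close>

lemma loops_in_subgroup:
  assumes N: "subgroup N K" and A: "A \<subseteq> X" "x\<^sub>0 \<in> A" "X \<subseteq> (\<Union>a\<in>A. V a)"
    and V: "\<And>a. a \<in> A \<Longrightarrow> openin (top_of_set X) (V a)" "\<And>a. a \<in> A \<Longrightarrow> path_connected (V a)"
      "\<And>a. a \<in> A \<Longrightarrow> a \<in> V a"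
    and same: "\<And>a b p q. \<lbrakk>a \<in> A; b \<in> A; V a \<inter> V b \<noteq> {}; path p; path_image p \<subseteq> V a \<union> V b;
      path q; path_image q \<subseteq> V a \<union> V b; pathstart p = pathstart q; pathfinish p = pathfinish q\<rbrakk>
      \<Longrightarrow> \<Phi> p = \<Phi> q"
    and g: "\<And>a. a \<in> A \<Longrightarrow> g a \<in> carrier K" "g x\<^sub>0 = \<one>"
    and \<delta>: "\<And>a b. \<lbrakk>a \<in> A; b \<in> A; V a \<inter> V b \<noteq> {}\<rbrakk> \<Longrightarrow> path (\<delta> a b) \<and> path_image (\<delta> a b) \<subseteq> V a \<union> V b
      \<and> pathstart (\<delta> a b) = a \<and> pathfinish (\<delta> a b) = b"
    and gen: "\<And>a b. \<lbrakk>a \<in> A; b \<in> A; V a \<inter> V b \<noteq> {}\<rbrakk> \<Longrightarrow> g a \<otimes> \<Phi> (\<delta> a b) \<otimes> inv (g b) \<in> N"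
    and p: "p \<in> loops_at X x\<^sub>0"
  shows "\<Phi> p \<in> N"
proof -
  have p': "path p" "path_image p \<subseteq> X" "p 0 = x\<^sub>0" "p 1 = x\<^sub>0"
    using p by (auto simp: loops_at_def pathstart_def pathfinish_def)
  have VX: "V a \<subseteq> X" if "a \<in> A" for a using V(1)[OF that] openin_imp_subset by blast
  have step: "g a \<otimes> \<Phi> q \<otimes> inv (g b) \<in> N"
    if "a \<in> A" "b \<in> A" "V a \<inter> V b \<noteq> {}" "path q" "path_image q \<subseteq> V a \<union> V b"
      "pathstart q = a" "pathfinish q = b" for a b q
    using same[of a b q "\<delta> a b"] \<delta>[of a b] gen[of a b] that by simp
  \<comment> \<open>The invariant: \<open>p\<close> up to \<open>t\<close>, closed up through a
    member around \<open>p t\<close>, has its value in \<open>N\<close>. Quantifying over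
    \<open>a\<close> and \<open>\<sigma>\<close> allows a change of member at every point.\<close>
  define good where "good t \<longleftrightarrow> (\<forall>a\<in>A. \<forall>\<sigma>. path \<sigma> \<and> path_image \<sigma> \<subseteq> V a \<and> pathstart \<sigma> = p t \<and>
    pathfinish \<sigma> = a \<longrightarrow> \<Phi> (p \<circ> linepath 0 t) \<otimes> \<Phi> \<sigma> \<otimes> inv (g a) \<in> N)" for t
  have seg: "closed_segment s t \<subseteq> {0..1}" if "s \<in> {0..1}" "t \<in> {0..1}" for s t :: real
    using that by (intro closed_segment_subset) auto
  have sub: "path (p \<circ> linepath s t)" "path_image (p \<circ> linepath s t) \<subseteq> X"
      "pathstart (p \<circ> linepath s t) = p s" "pathfinish (p \<circ> linepath s t) = p t"
    if "s \<in> {0..1}" "t \<in> {0..1}" for s t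
    using homotopic_paths_compose_interval[OF p'(1,2), of "linepath s t" "linepath s t"] seg[OF that]
    by (simp_all add: pathfinish_compose pathstart_compose)
  have "good 1"
  \<comment> \<open>Connectedness of \<open>{0..1}\<close> replaces a Lebesgue number subdivision:
    near each \<open>t\<close>, \<open>good\<close> only has to pass between any two points, in
    either direction.\<close>
  proof (rule connected_induction_simple[of "{0..1::real}" 0])
    show "good 0"
      unfolding good_def
    proof (intro ballI allI impI, elim conjE)
      fix a \<sigma> assume a: "a \<in> A" and \<sigma>: "path \<sigma>" "path_image \<sigma> \<subseteq> V a" "pathstart \<sigma> = p 0" "pathfinish \<sigma> = a"
      have "x\<^sub>0 \<in> V a" using \<sigma> p' pathstart_in_path_image by force
      then have "V x\<^sub>0 \<inter> V a \<noteq> {}" using A V(3) by blast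
      then have "g x\<^sub>0 \<otimes> \<Phi> \<sigma> \<otimes> inv (g a) \<in> N"
        using a A \<sigma> p' by (intro step) auto
      moreover have "p \<circ> linepath 0 0 = (\<lambda>_. x\<^sub>0)" using p' by (auto simp: linepath_def)
      ultimately show "\<Phi> (p \<circ> linepath 0 0) \<otimes> \<Phi> \<sigma> \<otimes> inv (g a) \<in> N"
        using A g by auto
    qed
  next
    fix t :: real assume t: "t \<in> {0..1}"
    then have "p t \<in> X" using p' by (auto simp: path_image_def)
    then obtain a where a: "a \<in> A" "p t \<in> V a" using A by blast
    obtain U where U: "open U" "V a = X \<inter> U" using V(1)[OF a(1)] by (auto simp: openin_open)
    have "continuous_on {0..1} p" using p' by (simp add: path_def)
    then obtain e where e: "e > 0" "\<And>s. s \<in> {0..1} \<Longrightarrow> dist s t < e \<Longrightarrow> p s \<in> U"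
    proof -
      assume cont: "continuous_on {0..1} p" and *: "\<And>e. e > 0 \<Longrightarrow> (\<And>s. s \<in> {0..1} \<Longrightarrow> dist s t < e \<Longrightarrow> p s \<in> U) \<Longrightarrow> thesis"
      obtain d where d: "d > 0" "ball (p t) d \<subseteq> U" using U a open_contains_ball by blast
      obtain e where "e > 0" "\<forall>s\<in>{0..1}. dist s t < e \<longrightarrow> dist (p s) (p t) < d"
        using cont t d(1) unfolding continuous_on_iff by blast
      then show thesis using *[of e] d by (auto simp: dist_commute subset_iff)
    qed
    define T where "T = {0..1} \<inter> ball t e"
    have T_p: "p s \<in> V a" if "s \<in> T" for s
      using that e U p' by (auto simp: T_def dist_commute path_image_def)
    have conv: "convex T" unfolding T_def by (intro convex_Int) auto
    have "good s'" if s: "s \<in> T" "s' \<in> T" and good: "good s" for s s'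
      unfolding good_def
    proof (intro ballI allI impI, elim conjE)
      fix b \<sigma> assume b: "b \<in> A" and \<sigma>: "path \<sigma>" "path_image \<sigma> \<subseteq> V b" "pathstart \<sigma> = p s'" "pathfinish \<sigma> = b"
      have s01: "s \<in> {0..1}" "s' \<in> {0..1}" using s by (auto simp: T_def)
      \<comment> \<open>A detour to the centre \<open>a\<close> of the member containing the whole
        piece of \<open>p\<close>. It splits the value at \<open>s'\<close> into the value known at
        \<open>s\<close> and one edge from \<open>a\<close> to \<open>b\<close>, both in
        \<open>N\<close>.\<close>
      obtain \<tau> where \<tau>: "path \<tau>" "path_image \<tau> \<subseteq> V a" "pathstart \<tau> = p s'" "pathfinish \<tau> = a"
        using V(2,3)[OF a(1)] T_p[OF s(2)] unfolding path_connected_def by metis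
      have "closed_segment s s' \<subseteq> T" using conv s by (simp add: closed_segment_subset)
      then have seg_V: "path_image (p \<circ> linepath s s') \<subseteq> V a"
        using T_p by (auto simp: path_image_compose)
      let ?s = "p \<circ> linepath s s'"
      note ss = sub[OF s01]
      have X: "path_image \<tau> \<subseteq> X" "path_image \<sigma> \<subseteq> X" using \<tau> \<sigma> VX a b by blast+
      have 0: "(0::real) \<in> {0..1}" by simp
      note s0 = sub[OF 0 s01(1)] sub[OF 0 s01(2)]
      have "\<Phi> (p \<circ> linepath 0 s) \<otimes> \<Phi> (?s +++ \<tau>) \<otimes> inv (g a) \<in> N"
        using good a \<tau> ss seg_V unfolding good_def
        by (simp add: subset_path_image_join)
      then have 1: "\<Phi> (p \<circ> linepath 0 s) \<otimes> (\<Phi> ?s \<otimes> \<Phi> \<tau>) \<otimes> inv (g a) \<in> N"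
        using \<tau> ss X by (simp add: join)
      have "p s' \<in> V b" using \<sigma> pathstart_in_path_image by force
      then have "V a \<inter> V b \<noteq> {}" using T_p[OF s(2)] by blast
      moreover have "path_image (reversepath \<tau> +++ \<sigma>) \<subseteq> V a \<union> V b"
        using \<tau> \<sigma> by (intro subset_path_image_join) auto
      ultimately have "g a \<otimes> \<Phi> (reversepath \<tau> +++ \<sigma>) \<otimes> inv (g b) \<in> N"
        using a b \<tau> \<sigma> by (intro step) simp_all
      then have 2: "g a \<otimes> (inv (\<Phi> \<tau>) \<otimes> \<Phi> \<sigma>) \<otimes> inv (g b) \<in> N"
        using \<tau> \<sigma> X by (simp add: join reverse)
      have in_K: "\<Phi> \<tau> \<in> carrier K" "\<Phi> \<sigma> \<in> carrier K" "\<Phi> ?s \<in> carrier K"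
        "\<Phi> (p \<circ> linepath 0 s) \<in> carrier K" "g a \<in> carrier K" "g b \<in> carrier K"
        using \<tau> \<sigma> X ss s0 a b g by auto
      have "\<Phi> (p \<circ> linepath 0 s') = \<Phi> (p \<circ> linepath 0 s) \<otimes> \<Phi> ?s"
        using subpath_join[OF p'(1,2) 0 s01] .
      then have "\<Phi> (p \<circ> linepath 0 s') \<otimes> \<Phi> \<sigma> \<otimes> inv (g b) =
          (\<Phi> (p \<circ> linepath 0 s) \<otimes> (\<Phi> ?s \<otimes> \<Phi> \<tau>) \<otimes> inv (g a)) \<otimes>
          (g a \<otimes> (inv (\<Phi> \<tau>) \<otimes> \<Phi> \<sigma>) \<otimes> inv (g b))"
        using in_K by (simp add: m_assoc inv_solve_left' flip: m_assoc[of "inv (g a)"] m_assoc[of "\<Phi> \<tau>" "inv (\<Phi> \<tau>)"])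
      then show "\<Phi> (p \<circ> linepath 0 s') \<otimes> \<Phi> \<sigma> \<otimes> inv (g b) \<in> N"
        using subgroup.m_closed[OF N 1 2] by simp
    qed
    moreover have "openin (top_of_set {0..1}) T" "t \<in> T"
      using t e by (auto simp: T_def openin_open_Int)
    ultimately show "\<exists>T. openin (top_of_set {0..1}) T \<and> t \<in> T \<and> (\<forall>x\<in>T. \<forall>y\<in>T. good x \<longrightarrow> good y)"
      by blast
  qed auto
  \<comment> \<open>The invariant at \<open>1\<close>, with centre \<open>x\<^sub>0\<close> and a
    constant closing path.\<close>
  then have "\<Phi> (p \<circ> linepath 0 1) \<otimes> \<Phi> (\<lambda>_. x\<^sub>0) \<otimes> inv (g x\<^sub>0) \<in> N"
    unfolding good_def using A V(3) p' by auto
  moreover have "p \<circ> linepath 0 1 = p" by (auto simp: linepath_def)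
  ultimately show ?thesis using A p' g by (auto)
qed

end

text \<open>Reduces the separable case to \<open>\<kappa> = natLeq\<close>: balls of radius
  \<open>1 / Suc n\<close> about a countable dense set form a countable base.\<close>

lemma separable_imp_kappa_Lindelof:
  fixes X :: "'a::metric_space set"
  assumes "separable_space (top_of_set X)"
  shows "kappa_Lindelof_space natLeq (top_of_set X)"
proof -
  obtain C where C: "countable C" "C \<subseteq> X" "top_of_set X closure_of C = X"
    using assms by (auto simp: separable_space_def)
  have dense: "\<exists>c\<in>C. dist c x < e" if "x \<in> X" "e > 0" for x e
  proof -
    have "x \<in> top_of_set X closure_of C" using C that by simp
    moreover have "openin (top_of_set X) (X \<inter> ball x e)" by (simp add: openin_open_Int)
    ultimately have "\<exists>y. y \<in> C \<and> y \<in> X \<inter> ball x e"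
      unfolding in_closure_of using that by (metis IntI centre_in_ball)
    then show ?thesis by (auto simp: dist_commute)
  qed
  define \<B> where "\<B> = (\<lambda>(c, n). X \<inter> ball c (1 / Suc n)) ` (C \<times> (UNIV :: nat set))"
  have "second_countable (top_of_set X)"
    unfolding second_countable_def
  proof (intro exI[of _ \<B>] conjI ballI allI impI)
    show "countable \<B>" unfolding \<B>_def using C by (intro countable_image countable_SIGMA) auto
    show "openin (top_of_set X) V" if "V \<in> \<B>" for V
      using that by (auto simp: \<B>_def openin_open_Int)
    fix U x assume U: "openin (top_of_set X) U \<and> x \<in> U"
    then obtain e where e: "e > 0" "X \<inter> ball x e \<subseteq> U" and x: "x \<in> X"
      by (metis openin_contains_ball inf_commute openin_imp_subset subsetD)
    \<comment> \<open>With radius below \<open>e / 2\<close>, any two points of the ball about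
      \<open>c\<close> are less than \<open>e\<close> apart, so once it contains \<open>x\<close> it
      lies in \<open>ball x e\<close>.\<close>
    obtain n where n: "1 / real (Suc n) < e / 2" using nat_approx_posE[of "e / 2"] e by auto
    obtain c where c: "c \<in> C" "dist c x < 1 / Suc n" using dense[OF x, of "1 / Suc n"] by auto
    have "ball c (1 / Suc n) \<subseteq> ball x e"
    proof
      fix y assume "y \<in> ball c (1 / Suc n)"
      then have "dist c y < 1 / Suc n" by simp
      moreover have "dist x y \<le> dist c x + dist c y" by (rule dist_triangle3)
      ultimately show "y \<in> ball x e" using c n by simp
    qed
    then have "X \<inter> ball c (1 / Suc n) \<subseteq> U" using e by blast
    moreover have "x \<in> X \<inter> ball c (1 / Suc n)" using c x by simp
    moreover have "X \<inter> ball c (1 / Suc n) \<in> \<B>" unfolding \<B>_def using c by blast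
    ultimately show "\<exists>V\<in>\<B>. x \<in> V \<and> V \<subseteq> U" by blast
  qed
  then have "Lindelof_space (top_of_set X)" by (rule second_countable_imp_Lindelof_space)
  then show ?thesis
    unfolding Lindelof_space_def kappa_Lindelof_space_def countable_card_le_natLeq
    by metis
qed

section \<open>Application to free products\<close>

context group_family
begin

lemma kill_antimono:
  "w \<in> words \<Longrightarrow> J \<subseteq> J' \<Longrightarrow> kill J' w \<noteq> [] \<Longrightarrow> kill J w \<noteq> []"
  by (metis kill_Nil kill_kill letters_if_words)

lemma small_loops_killed:
  fixes X :: "'a::metric_space set"
  assumes \<Phi>: "path_functor (free_product I G) X \<Phi>" and \<kappa>: "Cinfinite \<kappa>" and x: "x \<in> X"
  shows "\<exists>r J. r > 0 \<and> |J| \<le>o \<kappa> \<and> (\<forall>p\<in>loops_at (X \<inter> ball x r) x. kill J (\<Phi> p) = [])"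
proof (rule ccontr)
  assume "\<not> ?thesis"
  then have large: "\<exists>p\<in>loops_at (X \<inter> ball x r) x. kill J (\<Phi> p) \<noteq> []" if "r > 0" "|J| \<le>o \<kappa>" for r J
    using that by blast
  interpret \<Phi>: path_functor "free_product I G" X \<Phi> by fact
  define H where "H n = \<Phi> ` loops_at (X \<inter> ball x (1 / Suc n)) x" for n
  have H_words: "H n \<subseteq> words" for n
    using \<Phi>.closed by (auto simp: H_def loops_at_def)
  have "\<exists>R. finite R \<and> (\<forall>J. |J| \<le>o \<kappa> \<longrightarrow> (\<exists>w\<in>H n. kill J w \<noteq> [] \<and> support w \<inter> J \<subseteq> R))" for n
  proof (rule large_family_finite_kernel[OF \<kappa>, of "H n" support "\<lambda>J w. kill J w \<noteq> []"])
    show "\<exists>w\<in>H n. kill J w \<noteq> []" if "|J| \<le>o \<kappa>" for J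
      using large[of "1 / Suc n" J] that by (auto simp: H_def)
    show "kill J w \<noteq> []" if "w \<in> H n" "J \<subseteq> J'" "kill J' w \<noteq> []" for J J' w
      using kill_antimono that H_words by blast
  qed (simp, blast)
  then obtain R where R: "\<And>n. finite (R n)"
    "\<And>n J. |J| \<le>o \<kappa> \<Longrightarrow> \<exists>w\<in>H n. kill J w \<noteq> [] \<and> support w \<inter> J \<subseteq> R n"
    by metis
  \<comment> \<open>A countable union of finite kernels is small, and one \<open>J\<close> for all
    \<open>n\<close> means that a single endomorphism serves all levels.\<close>
  define J where "J = (\<Union>n. R n)"
  have J: "|J| \<le>o \<kappa>"
    using R(1) \<kappa> by (intro countable_ordLeq_Cinfinite) (auto simp: J_def countable_finite)
  have "\<exists>c d. c \<in> loops_at (X \<inter> ball x (1 / Suc n)) x \<and> d \<in> loops_at (X \<inter> ball x (1 / Suc n)) x \<and>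
      kill J (\<Phi> c) \<noteq> [] \<and> kill J (\<Phi> d) \<noteq> [] \<and>
      support (kill J (\<Phi> c)) \<inter> support (kill J (\<Phi> d)) = {}" for n
  proof -
    obtain c where c: "c \<in> H n" "kill J c \<noteq> []" using R(2)[OF J] by blast
    have "|support c| \<le>o \<kappa>"
      by (intro countable_ordLeq_Cinfinite \<kappa> countable_finite finite_support)
    then have "|J \<union> support c| \<le>o \<kappa>"
      using J \<kappa> by (intro Un_Cinfinite_bound)
    \<comment> \<open>Chosen after \<open>c\<close>: the word \<open>d\<close> meets the factors of
      \<open>c\<close> only inside \<open>R n\<close>, which \<open>kill J\<close> removes.\<close>
    then obtain d where d: "d \<in> H n" "kill (J \<union> support c) d \<noteq> []"
      "support d \<inter> (J \<union> support c) \<subseteq> R n"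
      using R(2) by blast
    have "kill J d \<noteq> []" using kill_antimono[of d J "J \<union> support c"] d H_words by blast
    moreover have "support (kill J c) \<inter> support (kill J d) = {}"
    proof -
      have "R n \<subseteq> J" by (auto simp: J_def)
      then show ?thesis using support_kill[of J c] support_kill[of J d] d(3) by blast
    qed
    ultimately show ?thesis using c d by (auto simp: H_def)
  qed
  then obtain c d where cd: "\<And>n. c n \<in> loops_at (X \<inter> ball x (1 / Suc n)) x"
      "\<And>n. d n \<in> loops_at (X \<inter> ball x (1 / Suc n)) x"
      "\<And>n. kill J (\<Phi> (c n)) \<noteq> []" "\<And>n. kill J (\<Phi> (d n)) \<noteq> []"
      "\<And>n. support (kill J (\<Phi> (c n))) \<inter> support (kill J (\<Phi> (d n))) = {}"
    by metis
  obtain w where w: "\<And>n. w n \<in> loops_at X x"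
      "\<And>n t. t \<in> {0..1} \<Longrightarrow> nest (c n) (d n) (w (Suc n)) t = w n t"
    using infinitely_nested_loops[of c X x d] cd by blast
  define \<Theta> where "\<Theta> p = kill J (\<Phi> p)" for p
  interpret \<Theta>: path_functor "free_product I G" X \<Theta>
    unfolding \<Theta>_def using \<Phi>.compose_hom[OF kill_hom] F.group_axioms by blast
  have cd_X: "c n \<in> loops_at X x" "d n \<in> loops_at X x" for n
    using cd(1,2)[of n] by (auto simp: loops_at_def)
  have words: "\<Theta> p \<in> words" if "p \<in> loops_at X x" for p
    using \<Theta>.closed that by (simp add: loops_at_def)
  have longer: "length (\<Theta> (w (Suc n))) < length (\<Theta> (w n))" for n
  proof -
    let ?w = "w (Suc n)"
    have "nest (c n) (d n) ?w \<in> loops_at X x" using cd_X w by (intro nest_loop)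
    then have "\<Theta> (w n) = \<Theta> (nest (c n) (d n) ?w)"
      using \<Theta>.eq_on[of "nest (c n) (d n) ?w" "w n"] w(2) by (simp add: loops_at_def)
    also have "\<dots> = foldr lm (\<Theta> ?w) (foldr lm (\<Theta> (c n))
        (foldr lm (word_inv (\<Theta> ?w)) (foldr lm (\<Theta> (d n)) (\<Theta> ?w))))"
      using cd_X[of n] w(1)[of "Suc n"] words[OF w(1), of "Suc n"]
      by (simp add: nest_def loops_at_def \<Theta>.join \<Theta>.reverse subset_path_image_join F_inv)
    finally show ?thesis
      using conj_word_longer[of "\<Theta> ?w" "\<Theta> (c n)" "\<Theta> (d n)"] words cd_X w(1) cd(3-5)[of n]
      by (simp add: \<Theta>_def)
  qed
  \<comment> \<open>Strictly decreasing lengths: \<open>n\<close> levels of nesting force the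
    outermost word to have length at least \<open>n\<close>, for every \<open>n\<close>.\<close>
  have "length (\<Theta> (w n)) + n \<le> length (\<Theta> (w 0))" for n
  proof (induction n)
    case (Suc n)
    then show ?case using longer[of n] by simp
  qed simp
  from this[of "Suc (length (\<Theta> (w 0)))"] show False by simp
qed

text \<open>The subgroup to which \<open>loops_in_subgroup\<close> will be applied.\<close>

lemma word_subgroup: "subgroup {w \<in> words. support w \<subseteq> S} (free_product I G)"
proof
  fix u w assume "u \<in> {w \<in> words. support w \<subseteq> S}" "w \<in> {w \<in> words. support w \<subseteq> S}"
  then show "u \<otimes>\<^bsub>free_product I G\<^esub> w \<in> {w \<in> words. support w \<subseteq> S}"
    using support_mult[of u w] by (auto simp: foldr_closed letters_if_words)
qed (auto simp: F_inv word_inv_closed, simp add: support_def)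

text \<open>Contrapositive form that yields both halves of the final theorem, the separable one with
  \<open>\<kappa> = natLeq\<close>.\<close>

theorem card_factors_le:
  fixes X :: "'a::metric_space set"
  assumes X: "path_connected X" "locally path_connected X" "x\<^sub>0 \<in> X"
    and \<kappa>: "Cinfinite \<kappa>" "kappa_Lindelof_space \<kappa> (top_of_set X)"
    and nontriv: "\<And>i. i \<in> I \<Longrightarrow> carrier (G i) \<noteq> {\<one>\<^bsub>G i\<^esub>}"
    and iso: "fundamental_group X x\<^sub>0 \<cong> free_product I G"
  shows "|I| \<le>o \<kappa>"
proof -
  obtain h where h: "h \<in> hom (fundamental_group X x\<^sub>0) (free_product I G)"
    "bij_betw h (carrier (fundamental_group X x\<^sub>0)) words"
    using iso by (auto simp: is_iso_def iso_def)
  obtain \<Phi> where \<Phi>: "path_functor (free_product I G) X \<Phi>"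
    and \<Phi>_loop: "\<And>p. p \<in> loops_at X x\<^sub>0 \<Longrightarrow> \<Phi> p = h (loop_homotopy X x\<^sub>0 `` {p})"
    using path_functor_extending[OF X(1,3) F.group_axioms h(1)] by blast
  interpret \<Phi>: path_functor "free_product I G" X \<Phi> by fact
  obtain r J where r: "\<And>x. x \<in> X \<Longrightarrow> r x > 0" and J: "\<And>x. x \<in> X \<Longrightarrow> |J x| \<le>o \<kappa>"
    and killed: "\<And>x p. x \<in> X \<Longrightarrow> p \<in> loops_at (X \<inter> ball x (r x)) x \<Longrightarrow> kill (J x) (\<Phi> p) = []"
    using small_loops_killed[OF \<Phi> \<kappa>(1)] by metis
  \<comment> \<open>A third of the radius leaves room for two intersecting members inside one of the
    balls \<open>ball x (r x)\<close>.\<close>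
  have "\<exists>U. openin (top_of_set X) U \<and> path_connected U \<and> x \<in> U \<and> U \<subseteq> X \<inter> ball x (r x / 3)"
    if "x \<in> X" for x
  proof -
    have "openin (top_of_set X) (X \<inter> ball x (r x / 3))" by (simp add: openin_open_Int)
    moreover have "x \<in> X \<inter> ball x (r x / 3)" using that r[OF that] by simp
    ultimately show ?thesis using X(2) unfolding locally_path_connected by blast
  qed
  then obtain V where V: "\<And>x. x \<in> X \<Longrightarrow> openin (top_of_set X) (V x)" "\<And>x. x \<in> X \<Longrightarrow> path_connected (V x)"
    "\<And>x. x \<in> X \<Longrightarrow> x \<in> V x" "\<And>x. x \<in> X \<Longrightarrow> V x \<subseteq> X \<inter> ball x (r x / 3)"
    by metis
  have "\<Union>(V ` X) = topspace (top_of_set X)" using V(3,4) by auto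
  then obtain \<V> where \<V>: "|\<V>| \<le>o \<kappa>" "\<V> \<subseteq> V ` X" "\<Union>\<V> = X"
    using \<kappa>(2) V(1) unfolding kappa_Lindelof_space_def by (metis imageE topspace_euclidean_subtopology)
  \<comment> \<open>One centre per member of the subcover keeps their number at most
    \<open>\<kappa>\<close>; \<open>x\<^sub>0\<close> is added so that the base point is a centre
    too.\<close>
  define a where "a = inv_into X V"
  have a: "a U \<in> X" "V (a U) = U" if "U \<in> \<V>" for U
    using \<V>(2) that inv_into_into[of U V X] f_inv_into_f[of U V X] by (auto simp: a_def)
  define A where "A = insert x\<^sub>0 (a ` \<V>)"
  have A: "A \<subseteq> X" "x\<^sub>0 \<in> A" using a X by (auto simp: A_def)
  have cover: "X \<subseteq> (\<Union>b\<in>A. V b)" 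
  proof
    fix x assume "x \<in> X"
    then obtain U where "U \<in> \<V>" "x \<in> U" using \<V>(3) by blast
    then show "x \<in> (\<Union>b\<in>A. V b)" using a(2)[of U] by (auto simp: A_def)
  qed
  have "|a ` \<V>| \<le>o \<kappa>" using \<V>(1) card_of_image ordLeq_transitive by blast
  moreover have "|{x\<^sub>0}| \<le>o \<kappa>" using \<kappa> by (intro countable_ordLeq_Cinfinite) auto
  ultimately have "|{x\<^sub>0} \<union> a ` \<V>| \<le>o \<kappa>" using \<kappa> by (intro Un_Cinfinite_bound)
  then have A_card: "|A| \<le>o \<kappa>" by (simp add: A_def)
  define K where "K = (\<Union>b\<in>A. J b)"
  have K: "|K| \<le>o \<kappa>" unfolding K_def using A_card J A \<kappa> by (intro UNION_Cinfinite_bound) auto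
  define \<Theta> where "\<Theta> p = kill K (\<Phi> p)" for p
  interpret \<Theta>: path_functor "free_product I G" X \<Theta>
    unfolding \<Theta>_def using \<Phi>.compose_hom[OF kill_hom] F.group_axioms by blast
  have \<Theta>_killed: "\<Theta> p = []" if "b \<in> A" "p \<in> loops_at (X \<inter> ball b (r b)) b" for b p
  proof -
    have "\<Phi> p \<in> words" using \<Phi>.closed that by (simp add: loops_at_def)
    moreover have "kill (J b) (\<Phi> p) = []" using killed that A by blast
    moreover have "J b \<subseteq> K" using that by (auto simp: K_def)
    ultimately show ?thesis
      using kill_kill[of "J b" K "\<Phi> p"] by (simp add: \<Theta>_def letters_if_words)
  qed
  have V_A: "b \<in> A \<Longrightarrow> V b \<subseteq> X \<inter> ball b (r b / 3)" "b \<in> A \<Longrightarrow> path_connected (V b)" "b \<in> A \<Longrightarrow> b \<in> V b"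
    "b \<in> A \<Longrightarrow> openin (top_of_set X) (V b)" for b
    using V A by blast+
  have V_dist: "dist b y < r b / 3" if "b \<in> A" "y \<in> V b" for b y
    using V_A(1)[OF that(1)] that(2) by auto
  \<comment> \<open>With \<open>b\<close> the centre of larger radius, a point of \<open>V c\<close>
    is reached via a common point \<open>z\<close> at distance less than
    \<open>r b / 3 + r c / 3 + r c / 3\<close>, which is at most \<open>r b\<close>. So
    \<open>\<Theta>\<close> kills all loops at \<open>b\<close> in the union.\<close>
  have same': "\<Theta> p = \<Theta> q"
    if bc: "b \<in> A" "c \<in> A" "V b \<inter> V c \<noteq> {}" "r c \<le> r b" and p: "path p" "path_image p \<subseteq> V b \<union> V c"
      and q: "path q" "path_image q \<subseteq> V b \<union> V c"
      and ends: "pathstart p = pathstart q" "pathfinish p = pathfinish q" for b c p q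
  proof (rule \<Theta>.eq_if_loops_trivial[of "V b \<union> V c" b])
    show "path_connected (V b \<union> V c)" using bc V_A by (intro path_connected_Un) auto
    show "V b \<union> V c \<subseteq> X" "b \<in> V b \<union> V c" using bc V_A by blast+
    obtain z where z: "z \<in> V b" "z \<in> V c" using bc by blast
    then have z': "dist b z < r b / 3" "dist c z < r c / 3" using V_dist bc by blast+
    have "V b \<union> V c \<subseteq> ball b (r b)"
    proof
      fix y assume "y \<in> V b \<union> V c"
      then have y: "dist b y < r b / 3 \<or> dist c y < r c / 3" using V_dist bc by blast
      have "dist b y \<le> dist b z + dist z c + dist c y"
        by (meson dist_triangle add_right_mono order_trans)
      then show "y \<in> ball b (r b)"
        using y z' bc r[of b] A zero_le_dist[of b y] by (auto simp: dist_commute)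
    qed
    then have "V b \<union> V c \<subseteq> X \<inter> ball b (r b)" using bc V_A by blast
    then show "\<Theta> l = \<one>\<^bsub>free_product I G\<^esub>" if "l \<in> loops_at (V b \<union> V c) b" for l
    proof -
      have "l \<in> loops_at (X \<inter> ball b (r b)) b"
        using that \<open>V b \<union> V c \<subseteq> X \<inter> ball b (r b)\<close> unfolding loops_at_def by blast
      then show ?thesis using \<Theta>_killed[OF bc(1)] by simp
    qed
  qed (use p q ends in auto)
  have same: "\<Theta> p = \<Theta> q"
    if "b \<in> A" "c \<in> A" "V b \<inter> V c \<noteq> {}" "path p" "path_image p \<subseteq> V b \<union> V c"
      "path q" "path_image q \<subseteq> V b \<union> V c" "pathstart p = pathstart q" "pathfinish p = pathfinish q"
    for b c p q
    using same'[of b c p q] same'[of c b p q] that by (cases "r c \<le> r b") (simp_all add: Un_commute Int_commute)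
  have "\<exists>\<gamma>. path \<gamma> \<and> path_image \<gamma> \<subseteq> X \<and> pathstart \<gamma> = x\<^sub>0 \<and> pathfinish \<gamma> = b \<and>
      (b = x\<^sub>0 \<longrightarrow> \<gamma> = (\<lambda>_. x\<^sub>0))" if "b \<in> A" for b
  proof (cases "b = x\<^sub>0")
    case True
    then show ?thesis using X by (intro exI[of _ "\<lambda>_. x\<^sub>0"]) auto
  next
    case False
    then show ?thesis using X(1,3) A that unfolding path_connected_def by blast
  qed
  then obtain \<gamma> where \<gamma>: "\<And>b. b \<in> A \<Longrightarrow> path (\<gamma> b) \<and> path_image (\<gamma> b) \<subseteq> X \<and> pathstart (\<gamma> b) = x\<^sub>0 \<and>
      pathfinish (\<gamma> b) = b \<and> (b = x\<^sub>0 \<longrightarrow> \<gamma> b = (\<lambda>_. x\<^sub>0))"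
    by metis
  have "\<exists>\<delta>. path \<delta> \<and> path_image \<delta> \<subseteq> V b \<union> V c \<and> pathstart \<delta> = b \<and> pathfinish \<delta> = c"
    if "b \<in> A" "c \<in> A" "V b \<inter> V c \<noteq> {}" for b c
  proof -
    have "path_connected (V b \<union> V c)" using that V_A by (intro path_connected_Un) auto
    moreover have "b \<in> V b \<union> V c" "c \<in> V b \<union> V c" using V_A(3) that by simp_all
    ultimately show ?thesis unfolding path_connected_def by simp
  qed
  then obtain \<delta> where \<delta>: "\<And>b c. b \<in> A \<Longrightarrow> c \<in> A \<Longrightarrow> V b \<inter> V c \<noteq> {} \<Longrightarrow>
      path (\<delta> b c) \<and> path_image (\<delta> b c) \<subseteq> V b \<union> V c \<and> pathstart (\<delta> b c) = b \<and> pathfinish (\<delta> b c) = c"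
    by metis
  let ?gen = "\<lambda>b c. \<Theta> (\<gamma> b) \<otimes>\<^bsub>free_product I G\<^esub> \<Theta> (\<delta> b c) \<otimes>\<^bsub>free_product I G\<^esub>
    inv\<^bsub>free_product I G\<^esub> \<Theta> (\<gamma> c)"
  \<comment> \<open>The factors occurring in the generators: finitely many for each of at most
    \<open>\<kappa>\<close> pairs.\<close>
  define S where "S = (\<Union>b\<in>A. \<Union>c\<in>A. support (?gen b c))"
  have S: "|S| \<le>o \<kappa>"
    unfolding S_def
    by (intro UNION_Cinfinite_bound A_card \<kappa> ballI
        countable_ordLeq_Cinfinite[OF \<kappa>(1) countable_finite[OF finite_support]])
  have support_\<Theta>: "support (\<Theta> p) \<subseteq> S" if "p \<in> loops_at X x\<^sub>0" for p
  proof -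
    have "\<Theta> p \<in> {w \<in> words. support w \<subseteq> S}"
    proof (rule \<Theta>.loops_in_subgroup[OF word_subgroup A cover V_A(4,2,3) same _ _ \<delta> _ that])
      fix b assume "b \<in> A"
      then show "\<Theta> (\<gamma> b) \<in> carrier (free_product I G)" using \<gamma> by (intro \<Theta>.closed) auto
    next
      show "\<Theta> (\<gamma> x\<^sub>0) = \<one>\<^bsub>free_product I G\<^esub>" using \<gamma>[OF A(2)] X(3) \<Theta>.const by simp
    next
      fix b c assume bc: "b \<in> A" "c \<in> A" "V b \<inter> V c \<noteq> {}"
      have "\<Theta> (\<gamma> b) \<in> words" "\<Theta> (\<gamma> c) \<in> words"
        using \<gamma> bc \<Theta>.closed by auto
      moreover have "\<Theta> (\<delta> b c) \<in> words"
      proof -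
        have "path_image (\<delta> b c) \<subseteq> X" using \<delta>[OF bc] V_A(1) bc by blast
        then show ?thesis using \<delta>[OF bc] \<Theta>.closed by simp
      qed
      ultimately have "?gen b c \<in> carrier (free_product I G)"
        by (simp add: F.m_closed F.inv_closed)
      moreover have "support (?gen b c) \<subseteq> S" unfolding S_def using bc by blast
      ultimately show "?gen b c \<in> {w \<in> words. support w \<subseteq> S}" by simp
    qed
    then show ?thesis by simp
  qed
  \<comment> \<open>By surjectivity of \<open>h\<close>, some loop has a single letter of factor
    \<open>i\<close> as its word. If \<open>i\<close> is not in \<open>K\<close>, the letter
    survives \<open>\<Theta>\<close>, so \<open>i\<close> lies in \<open>S\<close>.\<close>
  have "i \<in> K \<union> S" if i: "i \<in> I" for i
  proof (rule ccontr)
    assume not_in: "i \<notin> K \<union> S"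
    interpret Gi: group "G i" using grp i by blast
    obtain g where "g \<in> carrier (G i)" "g \<noteq> \<one>\<^bsub>G i\<^esub>" using nontriv[OF i] Gi.one_closed by blast
    then have word: "[(i, g)] \<in> words" using i by (simp add: words_Cons)
    then obtain C where "C \<in> carrier (fundamental_group X x\<^sub>0)" "h C = [(i, g)]"
      using h(2) by (metis bij_betw_imp_surj_on imageE)
    then obtain p where p: "p \<in> loops_at X x\<^sub>0" "\<Phi> p = [(i, g)]"
      using \<Phi>_loop by (auto simp: fundamental_group_def elim!: quotientE)
    have "\<Theta> p = [(i, g)]"
      using kill_id[OF word, of K] not_in p by (simp add: \<Theta>_def support_def)
    then show False using support_\<Theta>[OF p(1)] not_in by (simp add: support_def)
  qed
  then have "|I| \<le>o |K \<union> S|" by (intro card_of_mono1) blast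
  also have "|K \<union> S| \<le>o \<kappa>" using K S \<kappa> by (intro Un_Cinfinite_bound) auto
  finally show ?thesis .
qed

end

theorem corollary6p8:
  fixes X :: "'a::metric_space set" and x\<^sub>0 :: 'a
    and \<kappa> :: "'k rel"
    and I :: "'i set" and G :: "'i \<Rightarrow> ('g, 'm) monoid_scheme"
  assumes "path_connected X" and "locally path_connected X" and "x\<^sub>0 \<in> X"
    and "\<And>i. i \<in> I \<Longrightarrow> group (G i)"
    and "\<And>i. i \<in> I \<Longrightarrow> carrier (G i) \<noteq> {\<one>\<^bsub>G i\<^esub>}"
  shows "(separable_space (top_of_set X) \<and> uncountable I
            \<longrightarrow> \<not> fundamental_group X x\<^sub>0 \<cong> free_product I G) \<and>
         (Card_order \<kappa> \<and> cinfinite \<kappa> \<and> kappa_Lindelof_space \<kappa> (top_of_set X) \<and> \<kappa> <o |I|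
            \<longrightarrow> \<not> fundamental_group X x\<^sub>0 \<cong> free_product I G)"
proof -
  interpret group_family I G using assms(4) by (rule group_family.intro)
  show ?thesis
  proof (intro conjI impI notI)
    assume "separable_space (top_of_set X) \<and> uncountable I"
      and iso: "fundamental_group X x\<^sub>0 \<cong> free_product I G"
    then have "kappa_Lindelof_space natLeq (top_of_set X)" "uncountable I"
      by (auto intro: separable_imp_kappa_Lindelof)
    then show False
      using card_factors_le[OF assms(1-3) natLeq_Cinfinite _ assms(5) iso]
      by (simp add: countable_card_le_natLeq)
  next
    assume "Card_order \<kappa> \<and> cinfinite \<kappa> \<and> kappa_Lindelof_space \<kappa> (top_of_set X) \<and> \<kappa> <o |I|"
      and iso: "fundamental_group X x\<^sub>0 \<cong> free_product I G"
    then show False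
      using card_factors_le[OF assms(1-3) _ _ assms(5) iso, of \<kappa>] not_ordLess_ordLeq by blast
  qed
qed

end
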